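(* (Lower bound.) For every $\alpha\in(0,1/3)$ there exists a constant $c>0$ depending only on $\alpha$ such that for all integers $n,m\ge1$, all $\epsilon\in[0,1]$ and all $p\in[0,1]$, $$r^{\rm est}_\alpha(\epsilon,p)\ \ge\ c\left[\sqrt{\frac{p(1-p)}m}\Big(\frac1{\sqrt n}+\epsilon\Big)+\frac1m\Big(\frac1n+\epsilon\Big)\right].$$ (Upper bound.) There is a universal constant $c_0>0$ and, for every $\alpha\in(0,1)$, a constant $C>0$ depending only on $\alpha$ such that for all integers $n,m\ge1$ there exists an estimator $\widehat p=\widehat p(X_1,\dots,X_n)$, not depending on $\epsilon$, such that for every $\epsilon\in[0,1]$ with $\frac{\log(2/\alpha)}n+\epsilon\le c_0$, $$\inf_{p,Q}P_{\epsilon,p,Q}\left(|\widehat p-p|\le C\left[\sqrt{\frac{p(1-p)}m}\Big(\frac1{\sqrt n}+\epsilon\Big)+\frac1m\Big(\frac1n+\epsilon\Big)\right]\right)\ge1-\alpha.$$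
   Context: Let $n,m\ge 1$ be integers. For $\epsilon,p\in[0,1]$ and a probability distribution $Q$ on $\mathbb R$ put $P_{\epsilon,p,Q}=(1-\epsilon)\,\mathrm{Binomial}(m,p)+\epsilon Q$. The data $X_1,\dots,X_n$ are i.i.d. from $P_{\epsilon,p,Q}$, and $P_{\epsilon,p,Q}(E)$ denotes the probability of an event $E$ about $(X_1,\dots,X_n)$ under $P_{\epsilon,p,Q}^{\otimes n}$. Suprema and infima over $Q$ range over all probability distributions, over $p$ over $[0,1]$. Locally optimal estimation error: for $\epsilon,p,q\in[0,1]$, $$r^{\rm est}_\alpha(\epsilon,p,q)=\inf\Big\{r\ge0:\ \inf_{\widehat p}\ \sup_{\theta\in\{p,q\},\,Q}P_{\epsilon,\theta,Q}\big(|\widehat p-\theta|\ge r\big)\le\alpha\Big\},\qquad r^{\rm est}_\alpha(\epsilon,p)=\sup_{q\in[0,1]}r^{\rm est}_\alpha(\epsilon,p,q),$$ where the infimum is over all estimators $\widehat p=\widehat p(X_1,\dots,X_n)$. *)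

theory Defs
  imports "HOL-Probability.Probability"
begin

definition distributions :: "real measure set" where
  "distributions = {Q. prob_space Q \<and> sets Q = sets borel}"

definition binomial_law :: "nat \<Rightarrow> real \<Rightarrow> real measure" where
  "binomial_law m p = distr (measure_pmf (binomial_pmf m p)) borel real"

definition contaminated :: "nat \<Rightarrow> real \<Rightarrow> real \<Rightarrow> real measure \<Rightarrow> real measure" where
  "contaminated m \<epsilon> p Q = measure_of UNIV (sets borel)
     (\<lambda>A. ennreal (1 - \<epsilon>) * emeasure (binomial_law m p) A + ennreal \<epsilon> * emeasure Q A)"

text \<open>The sample \<open>X\<^sub>1, \<dots>, X\<^sub>n\<close> is a function indexed by \<open>{..<n}\<close>.\<close>

definition sample_law :: "nat \<Rightarrow> nat \<Rightarrow> real \<Rightarrow> real \<Rightarrow> real measure \<Rightarrow> (nat \<Rightarrow> real) measure" where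
  "sample_law n m \<epsilon> p Q = PiM {..<n} (\<lambda>_. contaminated m \<epsilon> p Q)"

definition estimators :: "nat \<Rightarrow> ((nat \<Rightarrow> real) \<Rightarrow> real) set" where
  "estimators n = borel_measurable (PiM {..<n} (\<lambda>_. borel))"

text \<open>All suprema and infima below are over nonempty bounded sets of reals when the parameters
  lie in the unit interval, so they agree with those in the extended reals.\<close>

definition worst_case_error ::
    "nat \<Rightarrow> nat \<Rightarrow> real \<Rightarrow> real \<Rightarrow> real \<Rightarrow> real \<Rightarrow> ((nat \<Rightarrow> real) \<Rightarrow> real) \<Rightarrow> real" where
  "worst_case_error n m \<epsilon> p q r phat =
     (SUP (\<theta>, Q) \<in> {p, q} \<times> distributions.
        \<P>(x in sample_law n m \<epsilon> \<theta> Q. \<bar>phat x - \<theta>\<bar> \<ge> r))"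

definition est_error_pair :: "nat \<Rightarrow> nat \<Rightarrow> real \<Rightarrow> real \<Rightarrow> real \<Rightarrow> real \<Rightarrow> real" where
  "est_error_pair n m \<alpha> \<epsilon> p q =
     Inf {r. r \<ge> 0 \<and> (INF phat \<in> estimators n. worst_case_error n m \<epsilon> p q r phat) \<le> \<alpha>}"

definition est_error :: "nat \<Rightarrow> nat \<Rightarrow> real \<Rightarrow> real \<Rightarrow> real \<Rightarrow> real" where
  "est_error n m \<alpha> \<epsilon> p = (SUP q \<in> {0..1}. est_error_pair n m \<alpha> \<epsilon> p q)"

definition rate :: "nat \<Rightarrow> nat \<Rightarrow> real \<Rightarrow> real \<Rightarrow> real" where
  "rate n m \<epsilon> p = sqrt (p * (1 - p) / real m) * (1 / sqrt (real n) + \<epsilon>)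
     + 1 / real m * (1 / real n + \<epsilon>)"

lemma binomial_law_distribution: "binomial_law m p \<in> distributions"
  unfolding distributions_def binomial_law_def
  by (auto intro!: prob_space.prob_space_distr measure_pmf.prob_space_axioms)

lemma sets_contaminated [simp, measurable_cong]: "sets (contaminated m \<epsilon> p Q) = sets borel"
  unfolding contaminated_def by (metis sets.sigma_sets_eq sets_measure_of space_borel subset_UNIV Pow_UNIV)

lemma space_contaminated [simp]: "space (contaminated m \<epsilon> p Q) = UNIV"
  unfolding contaminated_def by (metis space_measure_of subset_UNIV Pow_UNIV)

lemma emeasure_contaminated:
  assumes "Q \<in> distributions" "A \<in> sets borel"
  shows "emeasure (contaminated m \<epsilon> p Q) A =
    ennreal (1 - \<epsilon>) * emeasure (binomial_law m p) A + ennreal \<epsilon> * emeasure Q A"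
proof (rule emeasure_measure_of[OF contaminated_def])
  have B: "sets (binomial_law m p) = sets borel" and Q: "sets Q = sets borel"
    using binomial_law_distribution assms by (auto simp: distributions_def)
  show "countably_additive (sets (contaminated m \<epsilon> p Q))
     (\<lambda>A. ennreal (1 - \<epsilon>) * emeasure (binomial_law m p) A + ennreal \<epsilon> * emeasure Q A)"
    unfolding countably_additive_def sets_contaminated
  proof (intro allI impI)
    fix F :: "nat \<Rightarrow> real set"
    assume F: "range F \<subseteq> sets borel" "disjoint_family F"
    show "(\<Sum>i. ennreal (1 - \<epsilon>) * emeasure (binomial_law m p) (F i) + ennreal \<epsilon> * emeasure Q (F i))
      = ennreal (1 - \<epsilon>) * emeasure (binomial_law m p) (\<Union>i. F i) + ennreal \<epsilon> * emeasure Q (\<Union>i. F i)"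
      using F B Q by (simp add: suminf_add[symmetric] ennreal_suminf_cmult suminf_emeasure)
  qed
qed (use assms in \<open>auto simp: positive_def\<close>)

lemma contaminated_distribution:
  assumes "Q \<in> distributions" "\<epsilon> \<in> {0..1}"
  shows "contaminated m \<epsilon> p Q \<in> distributions"
proof -
  have "emeasure R UNIV = 1" if "R \<in> distributions" for R
    using that prob_space.emeasure_space_1[of R] sets_eq_imp_space_eq[of R borel]
    by (auto simp: distributions_def)
  then have "emeasure (contaminated m \<epsilon> p Q) UNIV = ennreal (1 - \<epsilon>) + ennreal \<epsilon>"
    using assms binomial_law_distribution by (simp add: emeasure_contaminated)
  also have "\<dots> = 1"
    using assms by (simp flip: ennreal_plus)
  finally show ?thesis
    by (auto simp: distributions_def intro: prob_spaceI)
qed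

lemma prob_space_sample_law:
  assumes "Q \<in> distributions" "\<epsilon> \<in> {0..1}"
  shows "prob_space (sample_law n m \<epsilon> p Q)"
  unfolding sample_law_def using contaminated_distribution[OF assms]
  by (intro prob_space_PiM) (auto simp: distributions_def)

lemma est_error_pair_le_1:
  assumes "\<alpha> \<ge> 0" "\<epsilon> \<in> {0..1}" "p \<in> {0..1}" "q \<in> {0..1}"
  shows "est_error_pair n m \<alpha> \<epsilon> p q \<le> 1"
proof (rule field_le_epsilon)
  fix e :: real assume e: "e > 0"
  have ne: "{p, q} \<times> distributions \<noteq> {}"
    using binomial_law_distribution by blast
  have nonneg: "0 \<le> worst_case_error n m \<epsilon> p q (1 + e) phat" for phat
  proof -
    have "bdd_above ((\<lambda>(\<theta>, Q). \<P>(x in sample_law n m \<epsilon> \<theta> Q. \<bar>phat x - \<theta>\<bar> \<ge> 1 + e))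
        ` ({p, q} \<times> distributions))"
      using assms by (intro bdd_aboveI[of _ 1])
        (auto intro!: prob_space.prob_le_1 prob_space_sample_law)
    then show ?thesis
      unfolding worst_case_error_def using binomial_law_distribution
      by (intro cSUP_upper2[where x = "(p, binomial_law 0 0)"]) auto
  qed
  have "worst_case_error n m \<epsilon> p q (1 + e) (\<lambda>_. p) \<le> 0"
    unfolding worst_case_error_def
  proof (rule cSUP_least[OF ne])
    fix x assume "x \<in> {p, q} \<times> distributions"
    then obtain \<theta> Q where x: "x = (\<theta>, Q)" "\<theta> \<in> {0..1}" using assms by auto
    then have "\<not> 1 + e \<le> \<bar>p - \<theta>\<bar>" using assms e by auto
    then show "(case x of (\<theta>, Q) \<Rightarrow> \<P>(x in sample_law n m \<epsilon> \<theta> Q. \<bar>p - \<theta>\<bar> \<ge> 1 + e)) \<le> 0"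
      using x by simp
  qed
  then have "(INF phat \<in> estimators n. worst_case_error n m \<epsilon> p q (1 + e) phat) \<le> \<alpha>"
    using assms nonneg
    by (intro cINF_lower2[where x = "\<lambda>_. p"]) (auto simp: estimators_def intro!: bdd_belowI[of _ 0])
  then show "est_error_pair n m \<alpha> \<epsilon> p q \<le> 1 + e"
    unfolding est_error_pair_def using e by (intro cInf_lower) (auto intro: bdd_belowI[of _ 0])
qed

end

theory Submission
  imports Defs
begin

text \<open>
  \<^bold>\<open>Lower bound.\<close> By the two-point method it suffices to exhibit, for each of the four summands of the
  rate, a parameter \<open>q\<close> at a distance of that order from \<open>p\<close> which the sample cannot tell apart from \<open>p\<close>
  for a suitable contamination (\<open>est_error_ge_half_gap\<close>). For the two summands with \<open>n\<close>, both hypotheses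
  are contaminated by \<open>Binomial(m, q)\<close>, and the likelihood ratio of the samples has second moment at most
  \<open>(1 + (p - q)\<^sup>2 / (q (1 - q))) ^ (n m)\<close> (\<open>est_error_ge_by_sampling\<close>). For the two summands with \<open>\<epsilon>\<close>, the
  total variation distance of the binomial laws is at most \<open>\<epsilon>\<close>, and contaminations exist that make both
  mixtures equal (\<open>contaminations_coincide\<close>). Choosing \<open>q\<close> on the side of \<open>1 / 2\<close> keeps \<open>q (1 - q)\<close> at
  least of the order of the larger of \<open>p (1 - p)\<close> and \<open>\<bar>p - q\<bar>\<close>, which produces both forms of the rate.

  \<^bold>\<open>Upper bound.\<close> For an observation \<open>k\<close> and a candidate \<open>q\<close> let the score be the mean of \<open>sgn (k - J)\<close>
  with \<open>J\<close> drawn from \<open>Binomial(m, q)\<close>. It is bounded by one, antitone in \<open>q\<close>, and has mean zero under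
  \<open>Binomial(m, q)\<close>; the estimator is the point where the total score of the sample changes its sign.
  Because of monotonicity, the estimate exceeds \<open>p + r\<close> only if the total score at the single point
  \<open>p + r\<close> is nonnegative, and likewise on the other side, so that a tail bound at two fixed points
  suffices.

  Two estimates make this sharp. The mean score at \<open>p + r\<close> is at most \<open>- m r / (36 s)\<close> with
  \<open>s = 1 + sqrt (m p (1 - p))\<close>, for all \<open>r\<close> up to order \<open>s / m\<close> (\<open>sign_mean_ge\<close>): as a function of the
  candidate it decreases at a rate of at least \<open>m\<close> times the probability that two independent binomial
  variables collide, and that probability is at least of order \<open>1 / s\<close> (\<open>binomial_collision_ge\<close>), by
  the Hellinger affinity and the inequalities of Chebyshev and Cauchy-Schwarz. Secondly, the score
  has second moment about a suitable point of order at most \<open>min 1 (m p (1 - p))\<close> (\<open>sign_score_second_moment\<close>), so that by a Bernstein bound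
  (\<open>score_sum_tail\<close>) a drift of order \<open>\<epsilon> + \<tau> + sqrt (min 1 (m p (1 - p)) \<tau>)\<close> with \<open>\<tau> = ln (2 / \<alpha>) / n\<close> is
  overcome with probability at most \<open>\<alpha> / 2\<close>. Equating the two gives the rate.
\<close>

section \<open>Binomial weights and binomial means\<close>

text \<open>The probability of \<open>k\<close> under \<open>Binomial(m, p)\<close>, as a polynomial in \<open>p\<close>
  that is defined for every real \<open>p\<close>; it vanishes for \<open>k > m\<close>.\<close>

definition binomial_weight :: "nat \<Rightarrow> real \<Rightarrow> nat \<Rightarrow> real" where
  "binomial_weight m p k = real (m choose k) * p ^ k * (1 - p) ^ (m - k)"

text \<open>The expectation of \<open>h\<close> under \<open>Binomial(m, p)\<close>, again a polynomial in \<open>p\<close>.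
  The recursion \<open>binomial_mean_Suc\<close>, which conditions on one of the \<open>m + 1\<close> trials, is what most
  facts below are derived from.\<close>

definition binomial_mean :: "nat \<Rightarrow> real \<Rightarrow> (nat \<Rightarrow> real) \<Rightarrow> real" where
  "binomial_mean m p h = (\<Sum>k\<le>m. binomial_weight m p k * h k)"

lemma binomial_weight_nonneg: "p \<in> {0..1} \<Longrightarrow> 0 \<le> binomial_weight m p k"
  by (auto simp: binomial_weight_def)

lemma binomial_weight_pos: "0 < p \<Longrightarrow> p < 1 \<Longrightarrow> k \<le> m \<Longrightarrow> 0 < binomial_weight m p k"
  by (auto simp: binomial_weight_def)

lemma binomial_weight_eq_0: "m < k \<Longrightarrow> binomial_weight m p k = 0"
  by (auto simp: binomial_weight_def)

lemma binomial_weight_Suc_0: "binomial_weight (Suc m) p 0 = (1 - p) * binomial_weight m p 0"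
  by (simp add: binomial_weight_def)

lemma binomial_weight_Suc_Suc:
  "binomial_weight (Suc m) p (Suc k) =
    p * binomial_weight m p k + (1 - p) * binomial_weight m p (Suc k)"
proof (cases "k < m")
  case True
  then have "m - k = Suc (m - Suc k)" by simp
  then show ?thesis by (simp add: binomial_weight_def algebra_simps)
qed (auto simp: binomial_weight_def algebra_simps not_less le_less)

lemma binomial_mean_0 [simp]: "binomial_mean 0 p h = h 0"
  by (simp add: binomial_mean_def binomial_weight_def)

lemma binomial_mean_Suc:
  "binomial_mean (Suc m) p h =
    p * binomial_mean m p (\<lambda>k. h (Suc k)) + (1 - p) * binomial_mean m p h"
proof -
  have "binomial_mean m p h = (\<Sum>k\<le>Suc m. binomial_weight m p k * h k)"
    by (simp add: binomial_mean_def binomial_weight_eq_0)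
  also have "\<dots> = binomial_weight m p 0 * h 0 + (\<Sum>k\<le>m. binomial_weight m p (Suc k) * h (Suc k))"
    by (subst sum.atMost_Suc_shift) simp
  finally have *: "binomial_mean m p h = binomial_weight m p 0 * h 0 +
      (\<Sum>k\<le>m. binomial_weight m p (Suc k) * h (Suc k))" .
  have "binomial_mean (Suc m) p h = (1 - p) * binomial_weight m p 0 * h 0 +
      (\<Sum>k\<le>m. (p * binomial_weight m p k + (1 - p) * binomial_weight m p (Suc k)) * h (Suc k))"
    unfolding binomial_mean_def
    by (subst sum.atMost_Suc_shift) (simp only: binomial_weight_Suc_0 binomial_weight_Suc_Suc)
  also have "(\<Sum>k\<le>m. (p * binomial_weight m p k + (1 - p) * binomial_weight m p (Suc k)) * h (Suc k))
      =
      p * binomial_mean m p (\<lambda>k. h (Suc k)) +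
      (1 - p) * (\<Sum>k\<le>m. binomial_weight m p (Suc k) * h (Suc k))"
    unfolding binomial_mean_def
    by (simp only: distrib_right sum.distrib mult.assoc sum_distrib_left)
  finally show ?thesis
    unfolding * by (simp only: distrib_left mult.assoc add_ac)
qed

lemma binomial_mean_add:
  "binomial_mean m p (\<lambda>k. f k + g k) = binomial_mean m p f + binomial_mean m p g"
  by (simp add: binomial_mean_def algebra_simps sum.distrib)

lemma binomial_mean_diff:
  "binomial_mean m p (\<lambda>k. f k - g k) = binomial_mean m p f - binomial_mean m p g"
  by (simp add: binomial_mean_def algebra_simps sum_subtractf)

lemma binomial_mean_cmult: "binomial_mean m p (\<lambda>k. c * f k) = c * binomial_mean m p f"
  by (simp add: binomial_mean_def sum_distrib_left mult_ac)

lemma binomial_mean_uminus: "binomial_mean m p (\<lambda>k. - f k) = - binomial_mean m p f"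
  by (simp add: binomial_mean_def sum_negf)

lemma binomial_mean_const [simp]: "binomial_mean m p (\<lambda>k. c) = c"
  by (induction m) (auto simp: binomial_mean_Suc algebra_simps)

lemma sum_binomial_weight: "(\<Sum>k\<le>m. binomial_weight m p k) = 1"
  using binomial_mean_const[of m p 1] by (simp add: binomial_mean_def del: binomial_mean_const)

lemma binomial_mean_mono:
  assumes "p \<in> {0..1}" "\<And>k. k \<le> m \<Longrightarrow> f k \<le> g k"
  shows "binomial_mean m p f \<le> binomial_mean m p g"
  unfolding binomial_mean_def using assms
  by (intro sum_mono mult_left_mono) (auto simp: binomial_weight_nonneg)

lemma binomial_mean_cong:
  "(\<And>k. k \<le> m \<Longrightarrow> f k = g k) \<Longrightarrow> binomial_mean m p f = binomial_mean m p g"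
  unfolding binomial_mean_def by (intro sum.cong) auto

lemma binomial_mean_swap:
  "binomial_mean m p (\<lambda>k. binomial_mean l q (\<lambda>j. h k j)) =
   binomial_mean l q (\<lambda>j. binomial_mean m p (\<lambda>k. h k j))"
proof -
  have "(\<Sum>k\<le>m. binomial_weight m p k * (\<Sum>j\<le>l. binomial_weight l q j * h k j)) =
        (\<Sum>k\<le>m. \<Sum>j\<le>l. binomial_weight l q j * (binomial_weight m p k * h k j))"
    by (simp add: sum_distrib_left mult_ac)
  also have "\<dots> = (\<Sum>j\<le>l. \<Sum>k\<le>m. binomial_weight l q j * (binomial_weight m p k * h k j))"
    by (rule sum.swap)
  finally show ?thesis
    by (simp add: binomial_mean_def sum_distrib_left)
qed

lemma abs_binomial_mean_le:
  assumes "p \<in> {0..1}" "\<And>k. k \<le> m \<Longrightarrow> \<bar>f k\<bar> \<le> c"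
  shows "\<bar>binomial_mean m p f\<bar> \<le> c"
proof -
  have "binomial_mean m p f \<le> binomial_mean m p (\<lambda>_. c)"
    by (rule binomial_mean_mono) (use assms abs_le_D1 in auto)
  moreover have "binomial_mean m p (\<lambda>_. - c) \<le> binomial_mean m p f"
  proof (rule binomial_mean_mono)
    show "- c \<le> f k" if "k \<le> m" for k
      using assms(2)[OF that] by linarith
  qed (use assms in auto)
  ultimately show ?thesis by simp
qed

lemma binomial_mean_id: "binomial_mean m p real = real m * p"
proof (induction m)
  case (Suc m)
  have "binomial_mean (Suc m) p real =
    p * binomial_mean m p (\<lambda>k. 1 + real k) + (1 - p) * binomial_mean m p real"
    by (simp add: binomial_mean_Suc)
  then show ?case using Suc by (simp add: binomial_mean_add algebra_simps)
qed simp

lemma binomial_mean_square: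
  "binomial_mean m p (\<lambda>k. (real k)\<^sup>2) = real m * p * (1 - p) + (real m * p)\<^sup>2"
proof (induction m)
  case (Suc m)
  have "(\<lambda>k. (real (Suc k))\<^sup>2) = (\<lambda>k. (real k)\<^sup>2 + (2 * real k + 1))"
    by (auto simp: power2_eq_square algebra_simps)
  then have "binomial_mean (Suc m) p (\<lambda>k. (real k)\<^sup>2) =
    p * (binomial_mean m p (\<lambda>k. (real k)\<^sup>2) + (2 * binomial_mean m p real + 1)) +
    (1 - p) * binomial_mean m p (\<lambda>k. (real k)\<^sup>2)"
    by (simp only: binomial_mean_Suc binomial_mean_add binomial_mean_cmult binomial_mean_const)
  then show ?case
    by (simp add: Suc.IH binomial_mean_id) (simp add: algebra_simps power2_eq_square)
qed simp

lemma binomial_variance: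
  "binomial_mean m p (\<lambda>k. (real k - real m * p)\<^sup>2) = real m * p * (1 - p)"
proof -
  have "(\<lambda>k. (real k - real m * p)\<^sup>2) =
      (\<lambda>k. ((real k)\<^sup>2 - (2 * (real m * p)) * real k) + (real m * p)\<^sup>2)"
    by (auto simp: power2_eq_square algebra_simps)
  then have "binomial_mean m p (\<lambda>k. (real k - real m * p)\<^sup>2) =
      binomial_mean m p (\<lambda>k. (real k)\<^sup>2) - (2 * (real m * p)) * binomial_mean m p real
          + (real m * p)\<^sup>2"
    by (simp only: binomial_mean_add binomial_mean_diff binomial_mean_cmult binomial_mean_const)
  then show ?thesis
    unfolding binomial_mean_square binomial_mean_id by (simp add: power2_eq_square)
qed

text \<open>Differentiating in \<open>p\<close> replaces \<open>h\<close> by its forward difference and removes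
  one trial.\<close>

lemma binomial_mean_has_derivative:
  "((\<lambda>p. binomial_mean (Suc m) p h) has_real_derivative
     real (Suc m) * binomial_mean m p (\<lambda>k. h (Suc k) - h k)) (at p)"
proof (induction m arbitrary: h)
  case 0
  then show ?case
    by (auto simp: binomial_mean_Suc intro!: derivative_eq_intros)
next
  case (Suc m)
  have "((\<lambda>p. p * binomial_mean (Suc m) p (\<lambda>k. h (Suc k)) + (1 - p) * binomial_mean (Suc m) p h)
     has_real_derivative
      (1 * binomial_mean (Suc m) p (\<lambda>k. h (Suc k)) +
       p * (real (Suc m) * binomial_mean m p (\<lambda>k. h (Suc (Suc k)) - h (Suc k)))
      + ((- 1) * binomial_mean (Suc m) p h
          + (1 - p) * (real (Suc m) * binomial_mean m p (\<lambda>k. h (Suc k) - h k))))) (at p)"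
    by (rule derivative_eq_intros Suc.IH[of "\<lambda>k. h (Suc k)"] Suc.IH[of h] refl | simp add: algebra_simps)+
  also have "1 * binomial_mean (Suc m) p (\<lambda>k. h (Suc k))
      + p * (real (Suc m) * binomial_mean m p (\<lambda>k. h (Suc (Suc k)) - h (Suc k)))
      + ((- 1) * binomial_mean (Suc m) p h + (1 - p) * (real (Suc m) * binomial_mean m p (\<lambda>k. h (Suc k) - h k)))
      = real (Suc (Suc m)) * binomial_mean (Suc m) p (\<lambda>k. h (Suc k) - h k)"
    unfolding binomial_mean_diff[of "Suc m"] 
    by (simp add: binomial_mean_Suc[of m] binomial_mean_diff[of m] algebra_simps)
  finally show ?case by (simp add: binomial_mean_Suc[of "Suc m"])
qed

lemma continuous_on_binomial_mean: "continuous_on S (\<lambda>p. binomial_mean m p h)"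
  unfolding binomial_mean_def binomial_weight_def by (intro continuous_intros)

lemma sets_binomial_law [simp, measurable_cong]: "sets (binomial_law m p) = sets borel"
  by (simp add: binomial_law_def)

lemma integral_binomial_law:
  assumes "p \<in> {0..1}" "f \<in> borel_measurable borel"
  shows "(\<integral>x. f x \<partial>binomial_law m p) = binomial_mean m p (\<lambda>k. f (real k))"
  unfolding binomial_law_def binomial_mean_def binomial_weight_def
  by (subst integral_distr) (use assms in \<open>auto simp: expectation_binomial_pmf'\<close>)

lemma nn_integral_binomial_law:
  assumes "p \<in> {0..1}" and [measurable]: "f \<in> borel_measurable borel" and "\<And>x. f x \<ge> 0"
  shows "(\<integral>\<^sup>+x. ennreal (f x) \<partial>binomial_law m p) = ennreal (binomial_mean m p (\<lambda>k. f (real k)))"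
proof -
  have "integrable (binomial_law m p) f"
    unfolding binomial_law_def by (subst integrable_distr_eq) (use assms in auto)
  then show ?thesis
    using assms by (subst nn_integral_eq_integral) (auto simp: integral_binomial_law)
qed

lemma emeasure_binomial_law:
  assumes "p \<in> {0..1}" "A \<in> sets borel"
  shows "emeasure (binomial_law m p) A = ennreal (binomial_mean m p (\<lambda>k. indicator A (real k)))"
proof -
  have "sets (binomial_law m p) = sets borel"
    by (simp add: binomial_law_def)
  then have "emeasure (binomial_law m p) A = (\<integral>\<^sup>+x. ennreal (indicator A x) \<partial>binomial_law m p)"
    using assms by (simp add: ennreal_indicator)
  also have "\<dots> = ennreal (binomial_mean m p (\<lambda>k. indicator A (real k)))"
    by (rule nn_integral_binomial_law) (use assms in auto)
  finally show ?thesis .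
qed

section \<open>Closeness and anti-concentration of binomial laws\<close>

lemma binomial_mean_lipschitz:
  assumes pq: "p \<in> {0..1}" "q \<in> {0..1}" and h: "\<And>k. 0 \<le> h k" "\<And>k. h k \<le> (1::real)"
  shows "\<bar>binomial_mean m p h - binomial_mean m q h\<bar> \<le> real m * \<bar>p - q\<bar>"
proof (cases m)
  case (Suc l)
  define F where "F = (\<lambda>p. binomial_mean m p h)"
  define F' where "F' = (\<lambda>z. real m * binomial_mean l z (\<lambda>k. h (Suc k) - h k))"
  have "(F has_field_derivative F' z) (at z within {0..1})" for z
    unfolding F_def F'_def Suc
    by (rule has_field_derivative_at_within[OF binomial_mean_has_derivative])
  moreover have "norm (F' z) \<le> real m" if "z \<in> {0..1}" for z
  proof -
    have "\<bar>h (Suc k) - h k\<bar> \<le> 1" for k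
      using h(1)[of k] h(1)[of "Suc k"] h(2)[of k] h(2)[of "Suc k"] by linarith
    then have "\<bar>binomial_mean l z (\<lambda>k. h (Suc k) - h k)\<bar> \<le> 1"
      by (intro abs_binomial_mean_le that)
    then show ?thesis
      unfolding F'_def real_norm_def abs_mult abs_of_nat by (intro mult_left_le) auto
  qed
  ultimately have "norm (F p - F q) \<le> real m * norm (p - q)"
    using pq by (intro field_differentiable_bound[of "{0..1}" F F']) auto
  then show ?thesis by (simp only: F_def real_norm_def)
qed simp

lemma chi_square_binomial:
  assumes "0 < q" "q < 1"
  shows "(\<Sum>k\<le>m. (binomial_weight m p k)\<^sup>2 / binomial_weight m q k) =
    (1 + (p - q)\<^sup>2 / (q * (1 - q))) ^ m"
proof -
  have "(binomial_weight m p k)\<^sup>2 / binomial_weight m q k =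
    real (m choose k) * (p\<^sup>2 / q) ^ k * ((1 - p)\<^sup>2 / (1 - q)) ^ (m - k)" if "k \<le> m" for k
  proof -
    have "(c * a * b)\<^sup>2 / (c * a' * b') = c * (a\<^sup>2 / a') * (b\<^sup>2 / b')"
      if "c > 0" "a' > 0" "b' > 0" for a b c a' b' :: real
      using that by (simp add: field_simps power2_eq_square)
    moreover have "real (m choose k) > 0" using that by simp
    ultimately show ?thesis using assms
      by (simp add: binomial_weight_def power_divide flip: power_mult power2_eq_square)
        (simp add: mult.commute power_mult)
  qed
  then have "(\<Sum>k\<le>m. (binomial_weight m p k)\<^sup>2 / binomial_weight m q k) =
    (p\<^sup>2 / q + (1 - p)\<^sup>2 / (1 - q)) ^ m"
    by (simp add: binomial_ring)
  also have "p\<^sup>2 / q + (1 - p)\<^sup>2 / (1 - q) = 1 + (p - q)\<^sup>2 / (q * (1 - q))"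
    using assms by (simp add: field_simps power2_eq_square)
  finally show ?thesis .
qed

text \<open>The Hellinger affinity of two binomial laws is the \<open>m\<close>-th power of that of
  two Bernoulli laws.\<close>

lemma affinity_binomial:
  assumes "p \<in> {0..1}" "q \<in> {0..1}"
  shows "(\<Sum>k\<le>m. sqrt (binomial_weight m p k * binomial_weight m q k)) =
    (sqrt (p * q) + sqrt ((1 - p) * (1 - q))) ^ m"
proof -
  have "sqrt (binomial_weight m p k * binomial_weight m q k) =
     real (m choose k) * sqrt (p * q) ^ k * sqrt ((1 - p) * (1 - q)) ^ (m - k)" for k
  proof -
    have "binomial_weight m p k * binomial_weight m q k =
      (real (m choose k))\<^sup>2 * (p * q) ^ k * ((1 - p) * (1 - q)) ^ (m - k)"
      by (simp add: binomial_weight_def power_mult_distrib power2_eq_square)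
    then show ?thesis by (simp add: real_sqrt_mult real_sqrt_power)
  qed
  then show ?thesis by (simp add: binomial_ring)
qed

text \<open>The quantity \<open>s\<close>, one plus the standard deviation of \<open>Binomial(m, p)\<close>, is the
  natural scale: if the means \<open>m p\<close> and \<open>m q\<close> differ by at most \<open>s / 8\<close>, the affinity of the binomial
  laws stays bounded below, by Bernoulli's inequality. The Hellinger distance is controlled by \<open>\<bar>p - q\<bar>\<close> when \<open>m p (1 - p) \<le> 1\<close>
  and by \<open>(p - q)\<^sup>2 / (p (1 - p))\<close> otherwise.\<close>

lemma affinity_Bernoulli_ge:
  fixes s p q :: real and m :: nat
  defines "s \<equiv> 1 + sqrt (real m * (p * (1 - p)))"
  assumes pq: "p \<in> {0..1}" "q \<in> {0..1}" and m: "m \<ge> 1" and close: "\<bar>p - q\<bar> \<le> s / (8 * real m)"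
  shows "real m * (1 - (sqrt (p * q) + sqrt ((1 - p) * (1 - q)))) \<le> 1 / 4"
proof -
  have sq: "(sqrt a - sqrt b)\<^sup>2 \<le> \<bar>a - b\<bar>" "a * (sqrt a - sqrt b)\<^sup>2 \<le> (a - b)\<^sup>2"
    if "a \<ge> 0" "b \<ge> 0" for a b :: real
  proof -
    have e: "a - b = (sqrt a - sqrt b) * (sqrt a + sqrt b)"
      using that by (simp add: algebra_simps)
    have "(sqrt a - sqrt b)\<^sup>2 = \<bar>sqrt a - sqrt b\<bar> * \<bar>sqrt a - sqrt b\<bar>"
      by (simp add: power2_eq_square)
    also have "\<dots> \<le> \<bar>sqrt a - sqrt b\<bar> * \<bar>sqrt a + sqrt b\<bar>"
      using that by (intro mult_left_mono) (auto simp: abs_le_iff)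
    finally show "(sqrt a - sqrt b)\<^sup>2 \<le> \<bar>a - b\<bar>"
      by (simp add: e abs_mult)
    have "a = (sqrt a)\<^sup>2" using that by simp
    also have "\<dots> \<le> (sqrt a + sqrt b)\<^sup>2"
      using that by (intro power_mono) auto
    finally have "a * (sqrt a - sqrt b)\<^sup>2 \<le> (sqrt a + sqrt b)\<^sup>2 * (sqrt a - sqrt b)\<^sup>2"
      by (intro mult_right_mono) auto
    then show "a * (sqrt a - sqrt b)\<^sup>2 \<le> (a - b)\<^sup>2"
      by (subst e) (simp add: power_mult_distrib mult.commute)
  qed
  define u where "u = (sqrt p - sqrt q)\<^sup>2"
  define v where "v = (sqrt (1 - p) - sqrt (1 - q))\<^sup>2"
  have uv: "1 - (sqrt (p * q) + sqrt ((1 - p) * (1 - q))) = (u + v) / 2"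
    using pq unfolding u_def v_def power2_diff real_sqrt_mult by simp
  have u: "u \<le> \<bar>p - q\<bar>" "p * u \<le> (p - q)\<^sup>2" "u \<ge> 0"
    using sq[of p q] pq by (auto simp: u_def)
  have v: "v \<le> \<bar>p - q\<bar>" "(1 - p) * v \<le> (p - q)\<^sup>2" "v \<ge> 0"
    using sq[of "1 - p" "1 - q"] pq by (auto simp: v_def power2_commute[of p q] abs_minus_commute)
  define w where "w = p * (1 - p)"
  have w: "w \<ge> 0" "w \<le> p" "w \<le> 1 - p"
    using pq mult_left_le[of "1 - p" p] mult_left_le_one_le[of "1 - p" p] by (auto simp: w_def)
  define d where "d = real m * \<bar>p - q\<bar>"
  have d: "d \<le> s / 8" "d \<ge> 0"
    using close m by (auto simp: d_def field_simps)
  have "real m * u \<le> 1 / 4 \<and> real m * v \<le> 1 / 4"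
  proof (cases "real m * w \<le> 1")
    case True
    then have "s \<le> 2" by (simp add: s_def w_def)
    moreover have "real m * u \<le> d" "real m * v \<le> d"
      using u v by (auto simp: d_def intro: mult_left_mono)
    ultimately show ?thesis using d by linarith
  next
    case False
    then have s: "s \<le> 2 * sqrt (real m * w)" by (simp add: s_def w_def)
    have "(real m * \<bar>p - q\<bar>)\<^sup>2 \<le> (sqrt (real m * w) / 4)\<^sup>2"
      using d s by (intro power_mono) (auto simp: d_def)
    then have "real m * (real m * (p - q)\<^sup>2) \<le> real m * (w / 16)"
      using w by (simp add: power_mult_distrib power_divide power2_eq_square[of "real m"] mult_ac)
    then have *: "real m * (p - q)\<^sup>2 \<le> w / 16"
      using m by simp
    have wp: "w > 0" using False w m by (cases "w = 0") auto
    have "real m * (w * y) \<le> w / 16" if "x * y \<le> (p - q)\<^sup>2" "w \<le> x" "y \<ge> 0" for x y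
    proof -
      have "w * y \<le> x * y" using that by (intro mult_right_mono) auto
      then have "real m * (w * y) \<le> real m * (p - q)\<^sup>2"
        using that by (intro mult_left_mono) auto
      then show ?thesis using * by simp
    qed
    from this[of p u] this[of "1 - p" v] u v w
    have "w * (real m * u) \<le> w * (1 / 16)" "w * (real m * v) \<le> w * (1 / 16)"
      by (auto simp: mult_ac)
    then show ?thesis using wp unfolding mult_le_cancel_left_pos[OF wp] by simp
  qed
  then show ?thesis unfolding uv by (simp add: algebra_simps)
qed

text \<open>Two independent variables with laws \<open>Binomial(l, p)\<close> and \<open>Binomial(l, q)\<close> are
  equal with probability at least of order \<open>1 / s\<close>. On a window of width of order \<open>s\<close> around \<open>l p\<close> the
  affinity is still at least a half, because its complement has small probability under
  \<open>Binomial(l, p)\<close>; the Cauchy-Schwarz inequality on the window, which holds at most \<open>9 s\<close> integers, bounds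
  the collision probability from below by \<open>(1 / 4) / (9 s)\<close>. The law with \<open>l\<close> trials occurs because it
  is the one produced by differentiating a mean over \<open>l + 1\<close> trials.\<close>

lemma binomial_collision_ge:
  fixes s p q :: real and l :: nat
  defines "s \<equiv> 1 + sqrt (real (Suc l) * (p * (1 - p)))"
  assumes pq: "p \<in> {0..1}" "q \<in> {0..1}" and close: "\<bar>p - q\<bar> \<le> s / (8 * real (Suc l))"
  shows "1 / (36 * s) \<le> binomial_mean l q (binomial_weight l p)"
proof -
  define f g where "f = binomial_weight l p" and "g = binomial_weight l q"
  have fg: "f k \<ge> 0" "g k \<ge> 0" for k
    using pq by (auto simp: f_def g_def binomial_weight_nonneg)
  have s: "s \<ge> 1" using pq by (simp add: s_def)
  define W where "W = {k. k \<le> l \<and> \<bar>real k - real l * p\<bar> \<le> 4 * s}"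
  define V where "V = {..l} - W"
  have WV: "finite W" "finite V" "{..l} = W \<union> V" "W \<inter> V = {}"
    by (auto simp: W_def V_def)
  define \<rho> where "\<rho> = sqrt (p * q) + sqrt ((1 - p) * (1 - q))"
  have \<rho>: "0 \<le> \<rho>" "real (Suc l) * (1 - \<rho>) \<le> 1 / 4"
    using affinity_Bernoulli_ge[of p q "Suc l"] pq close by (auto simp: \<rho>_def s_def)
  have "3 / 4 \<le> \<rho> ^ l"
  proof (cases "\<rho> \<le> 1")
    case True
    then have "real l * (1 - \<rho>) \<le> real (Suc l) * (1 - \<rho>)"
      by (intro mult_right_mono) auto
    then have "3 / 4 \<le> 1 + real l * (\<rho> - 1)"
      using \<rho> by (simp add: algebra_simps)
    also have "\<dots> \<le> (1 + (\<rho> - 1)) ^ l"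
      using \<rho> by (intro Bernoulli_inequality) auto
    finally show ?thesis by simp
  next
    case False
    then have "1 \<le> \<rho> ^ l" by (intro one_le_power) auto
    then show ?thesis by simp
  qed
  also have "\<rho> ^ l = (\<Sum>k\<in>W. sqrt (f k * g k)) + (\<Sum>k\<in>V. sqrt (f k * g k))"
    using affinity_binomial[OF pq, of l] WV
    by (simp add: \<rho>_def f_def g_def sum.union_disjoint)
  finally have total: "3 / 4 \<le> (\<Sum>k\<in>W. sqrt (f k * g k)) + (\<Sum>k\<in>V. sqrt (f k * g k))" .
  \<comment> \<open>Chebyshev's inequality outside the window\<close>
  have "(4 * s)\<^sup>2 * sum f V \<le> (\<Sum>k\<in>V. f k * (real k - real l * p)\<^sup>2)"
    unfolding sum_distrib_left
  proof (rule sum_mono)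
    fix k assume "k \<in> V"
    then have "4 * s \<le> \<bar>real k - real l * p\<bar>" by (auto simp: V_def W_def)
    then have "(4 * s)\<^sup>2 \<le> \<bar>real k - real l * p\<bar>\<^sup>2"
      using s by (intro power_mono) auto
    then show "(4 * s)\<^sup>2 * f k \<le> f k * (real k - real l * p)\<^sup>2"
      using fg by (subst mult.commute) (auto intro: mult_left_mono)
  qed
  also have "\<dots> \<le> (\<Sum>k\<le>l. f k * (real k - real l * p)\<^sup>2)"
    using fg by (intro sum_mono2) (auto simp: V_def)
  also have "\<dots> = real l * p * (1 - p)"
    using binomial_variance[of l p] by (simp add: binomial_mean_def f_def)
  also have "\<dots> \<le> s\<^sup>2"
  proof -
    define x where "x = real (Suc l) * (p * (1 - p))"
    have x: "x \<ge> 0" using pq by (auto simp: x_def)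
    have "real l * p * (1 - p) \<le> x"
      using pq by (auto simp: x_def algebra_simps intro!: mult_right_mono mult_left_le)
    also have "x = (sqrt x)\<^sup>2" using x by simp
    also have "\<dots> \<le> s\<^sup>2" using x unfolding s_def x_def[symmetric] by (intro power_mono) auto
    finally show ?thesis .
  qed
  finally have "sum f V \<le> 1 / 16"
    using s by (simp add: power_mult_distrib)
  moreover have "sum g V \<le> 1"
    using sum_binomial_weight[of l q] fg WV sum_mono2[of "{..l}" V g] by (simp add: g_def)
  ultimately have "sum f V * sum g V \<le> (1 / 16) * 1"
    using fg by (intro mult_mono) (auto intro: sum_nonneg)
  moreover have "(\<Sum>k\<in>V. sqrt (f k) * sqrt (g k))\<^sup>2
      \<le> (\<Sum>k\<in>V. (sqrt (f k))\<^sup>2) * (\<Sum>k\<in>V. (sqrt (g k))\<^sup>2)"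
    by (rule Cauchy_Schwarz_ineq_sum)
  ultimately have "(\<Sum>k\<in>V. sqrt (f k * g k))\<^sup>2 \<le> (1 / 4)\<^sup>2"
    using fg by (simp add: real_sqrt_mult power2_eq_square)
  then have "(\<Sum>k\<in>V. sqrt (f k * g k)) \<le> 1 / 4"
    by (rule power2_le_imp_le) simp
  then have "1 / 2 \<le> (\<Sum>k\<in>W. sqrt (f k * g k) * 1)"
    using total by simp
  then have "(1 / 2)\<^sup>2 \<le> (\<Sum>k\<in>W. sqrt (f k * g k) * 1)\<^sup>2"
    by (intro power_mono) auto
  also have "\<dots> \<le> (\<Sum>k\<in>W. (sqrt (f k * g k))\<^sup>2) * (\<Sum>k\<in>W. 1\<^sup>2)"
    by (rule Cauchy_Schwarz_ineq_sum)
  also have "\<dots> = (\<Sum>k\<in>W. f k * g k) * real (card W)"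
    using fg by simp
  also have "\<dots> \<le> (\<Sum>k\<in>W. f k * g k) * (9 * s)"
  proof (rule mult_left_mono)
    have "W \<subseteq> nat ` {\<lceil>real l * p - 4 * s\<rceil>..\<lfloor>real l * p + 4 * s\<rfloor>}"
    proof
      fix k assume "k \<in> W"
      then have "int k \<in> {\<lceil>real l * p - 4 * s\<rceil>..\<lfloor>real l * p + 4 * s\<rfloor>}"
        by (auto simp: W_def ceiling_le_iff le_floor_iff abs_le_iff)
      then show "k \<in> nat ` {\<lceil>real l * p - 4 * s\<rceil>..\<lfloor>real l * p + 4 * s\<rfloor>}"
        by force
    qed
    then have "card W \<le> card {\<lceil>real l * p - 4 * s\<rceil>..\<lfloor>real l * p + 4 * s\<rfloor>}"
      by (meson card_image_le card_mono finite_atLeastAtMost_int finite_imageI order_trans)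
    also have "\<dots> = nat (\<lfloor>real l * p + 4 * s\<rfloor> - \<lceil>real l * p - 4 * s\<rceil> + 1)"
      by simp
    finally have "real (card W) \<le> real (nat (\<lfloor>real l * p + 4 * s\<rfloor> - \<lceil>real l * p - 4 * s\<rceil> + 1))"
      by simp
    also have "\<dots> \<le> 9 * s" using s by linarith
    finally show "real (card W) \<le> 9 * s" .
    show "0 \<le> (\<Sum>k\<in>W. f k * g k)"
      using fg by (intro sum_nonneg) auto
  qed
  also have "(\<Sum>k\<in>W. f k * g k) \<le> (\<Sum>k\<le>l. f k * g k)"
    using fg by (intro sum_mono2) (auto simp: W_def)
  finally have "1 / 4 \<le> (\<Sum>k\<le>l. f k * g k) * (9 * s)"
    using s by (simp add: power2_eq_square)
  then show ?thesis
    using s by (simp add: binomial_mean_def f_def g_def field_simps)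
qed

lemma binomial_mean_delta:
  assumes "j \<le> m"
  shows "binomial_mean m p (\<lambda>k. if k = j then 1 else 0) = binomial_weight m p j"
proof -
  have "binomial_mean m p (\<lambda>k. if k = j then 1 else 0) =
      (\<Sum>k\<le>m. if k = j then binomial_weight m p k else 0)"
    unfolding binomial_mean_def by (intro sum.cong) auto
  then show ?thesis using assms by simp
qed

text \<open>The forward difference of \<open>h\<close> at \<open>j\<close> is the probability that a
  \<open>Binomial(l + 1, p)\<close> variable equals \<open>j\<close> or \<open>j + 1\<close>, which is at least that of \<open>j\<close> under
  \<open>Binomial(l, p)\<close>.\<close>

lemma sign_mean_derivative_ge:
  fixes s p q :: real and l :: nat
  defines "s \<equiv> 1 + sqrt (real (Suc l) * (p * (1 - p)))"
  defines "h \<equiv> \<lambda>j::nat. binomial_mean (Suc l) p (\<lambda>k. sgn (real j - real k))"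
  assumes pq: "p \<in> {0..1}" "q \<in> {0..1}" and close: "\<bar>p - q\<bar> \<le> s / (8 * real (Suc l))"
  shows "1 / (36 * s) \<le> binomial_mean l q (\<lambda>j. h (Suc j) - h j)"
proof -
  have "binomial_weight l p j \<le> h (Suc j) - h j" if "j \<le> l" for j
  proof -
    have "h (Suc j) - h j
        = binomial_mean (Suc l) p (\<lambda>k. sgn (real (Suc j) - real k) - sgn (real j - real k))"
      by (simp add: h_def binomial_mean_diff)
    also have "\<dots> = binomial_mean (Suc l) p (\<lambda>k. (if k = j then 1 else 0) + (if k
        = Suc j then 1 else 0))"
      by (intro binomial_mean_cong) (auto simp: sgn_if)
    also have "\<dots> = binomial_weight (Suc l) p j + binomial_weight (Suc l) p (Suc j)"
      using that by (simp add: binomial_mean_add binomial_mean_delta)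
    also have "\<dots> \<ge> binomial_weight l p j"
    proof -
      have "binomial_weight (Suc l) p j \<ge> (1 - p) * binomial_weight l p j"
        using pq by (cases j) (auto simp: binomial_weight_Suc_0 binomial_weight_Suc_Suc binomial_weight_nonneg)
      moreover have "binomial_weight (Suc l) p (Suc j) \<ge> p * binomial_weight l p j"
        using pq by (auto simp: binomial_weight_Suc_Suc binomial_weight_nonneg)
      ultimately show ?thesis by (simp add: algebra_simps)
    qed
    finally show ?thesis .
  qed
  then have "binomial_mean l q (binomial_weight l p) \<le> binomial_mean l q (\<lambda>j. h (Suc j) - h j)"
    using pq by (intro binomial_mean_mono) auto
  then show ?thesis
    using binomial_collision_ge[of p q l] pq close by (simp add: s_def)
qed

text \<open>The mean of \<open>sgn (k - J)\<close> for \<open>J\<close> with law \<open>Binomial(m, q)\<close>. Up to an affine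
  map this is the distribution function of \<open>Binomial(m, q)\<close> at \<open>k\<close>, with the atom at \<open>k\<close> counted half.
  By antisymmetry the score has mean zero when \<open>k\<close> is itself drawn from \<open>Binomial(m, q)\<close>.\<close>

definition sign_score :: "nat \<Rightarrow> real \<Rightarrow> nat \<Rightarrow> real" where
  "sign_score m q k = binomial_mean m q (\<lambda>j. sgn (real k - real j))"

text \<open>The drift of the score at a wrong parameter \<open>q\<close>: it grows at least linearly in the
  distance to \<open>p\<close>, with slope of order \<open>m / s\<close>. This holds as long as the means differ by at most \<open>s / 8\<close>;
  no smallness or largeness of \<open>m p (1 - p)\<close> is involved.\<close>

lemma sign_mean_ge:
  fixes s p q :: real and m :: nat
  defines "s \<equiv> 1 + sqrt (real m * (p * (1 - p)))"
  assumes pq: "p \<in> {0..1}" "q \<in> {0..1}" and m: "m \<ge> 1"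
    and close: "\<bar>p - q\<bar> \<le> s / (8 * real m)"
  shows "p \<le> q \<Longrightarrow> binomial_mean m p (sign_score m q) \<le> - (real m * (q - p) / (36 * s))"
    and "q \<le> p \<Longrightarrow> binomial_mean m p (sign_score m q) \<ge> real m * (p - q) / (36 * s)"
proof -
  obtain l where l: "m = Suc l" using m by (cases m) auto
  define h where "h = (\<lambda>j::nat. binomial_mean m p (\<lambda>k. sgn (real j - real k)))"
  define \<psi> where "\<psi> = (\<lambda>t. binomial_mean m t h)"
  define \<psi>' where "\<psi>' = (\<lambda>t. real m * binomial_mean l t (\<lambda>j. h (Suc j) - h j))"
  have s: "s \<ge> 1" using pq by (simp add: s_def)
  have d: "(\<psi> has_real_derivative \<psi>' t) (at t)" for t
    unfolding \<psi>_def \<psi>'_def l by (rule binomial_mean_has_derivative)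
  have swap: "binomial_mean m p (sign_score m t) = - \<psi> t" for t
  proof -
    have "binomial_mean m p (sign_score m t) =
      binomial_mean m t (\<lambda>j. binomial_mean m p (\<lambda>k. sgn (real k - real j)))"
      unfolding sign_score_def by (rule binomial_mean_swap)
    also have "\<dots> = binomial_mean m t (\<lambda>j. - h j)"
      unfolding h_def binomial_mean_uminus[symmetric] sgn_minus[symmetric] minus_diff_eq ..
    finally show ?thesis by (simp add: binomial_mean_uminus \<psi>_def)
  qed
  have 0: "\<psi> p = 0"
  proof -
    have "\<psi> p = binomial_mean m p (sign_score m p)"
      unfolding \<psi>_def h_def sign_score_def ..
    then show ?thesis using swap[of p] by simp
  qed
  have ge: "\<psi>' t \<ge> real m * (1 / (36 * s))" if "min p q \<le> t" "t \<le> max p q" for t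
  proof -
    have t: "t \<in> {0..1}" "\<bar>p - t\<bar> \<le> \<bar>p - q\<bar>" using that pq by auto
    then show ?thesis
      unfolding \<psi>'_def h_def l s_def
      by (intro mult_left_mono sign_mean_derivative_ge) (use pq close in \<open>auto simp: l s_def\<close>)
  qed
  show "binomial_mean m p (sign_score m q) \<le> - (real m * (q - p) / (36 * s))" if "p \<le> q"
  proof (cases "p = q")
    case False
    then obtain z where z: "p < z" "z < q" "\<psi> q - \<psi> p = (q - p) * \<psi>' z"
      using MVT2[of p q \<psi> \<psi>'] d \<open>p \<le> q\<close> by auto
    have "(q - p) * (real m * (1 / (36 * s))) \<le> (q - p) * \<psi>' z"
      using z that by (intro mult_left_mono ge) auto
    then show ?thesis using z swap[of q] 0 by (simp add: mult.commute)
  qed (use 0 swap[of q] in simp)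
  show "binomial_mean m p (sign_score m q) \<ge> real m * (p - q) / (36 * s)" if "q \<le> p"
  proof (cases "p = q")
    case False
    then obtain z where z: "q < z" "z < p" "\<psi> p - \<psi> q = (p - q) * \<psi>' z"
      using MVT2[of q p \<psi> \<psi>'] d \<open>q \<le> p\<close> by auto
    have "(p - q) * (real m * (1 / (36 * s))) \<le> (p - q) * \<psi>' z"
      using z that by (intro mult_left_mono ge) auto
    then show ?thesis using z swap[of q] 0 by (simp add: mult.commute)
  qed (use 0 swap[of q] in simp)
qed

section \<open>An exponential tail bound for contaminated samples\<close>

lemma exp_le_quadratic:
  fixes y :: real
  assumes "\<bar>y\<bar> \<le> 1"
  shows "exp y \<le> 1 + y + y\<^sup>2"
proof (cases "y \<ge> 0")
  case True
  then show ?thesis using assms exp_bound[of y] by simp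
next
  case False
  define t where "t = - y"
  have t: "t \<ge> 0" using False by (simp add: t_def)
  have "1 + t + t\<^sup>2 / 2 \<le> exp t"
    using exp_lower_Taylor_quadratic[OF t] by simp
  moreover have q: "1 - t + t\<^sup>2 > 0"
    using assms t by (cases "t = 1") (auto simp: t_def intro: add_pos_nonneg)
  ultimately have "(1 + t + t\<^sup>2 / 2) * (1 - t + t\<^sup>2) \<le> exp t * (1 - t + t\<^sup>2)"
    by (intro mult_right_mono) auto
  moreover have "(1 + t + t\<^sup>2 / 2) * (1 - t + t\<^sup>2) = 1 + t\<^sup>2 / 2 + t ^ 3 / 2 + t ^ 4 / 2"
    by (simp add: field_simps power2_eq_square power3_eq_cube power4_eq_xxxx)
  moreover have "1 + t\<^sup>2 / 2 + t ^ 3 / 2 + t ^ 4 / 2 \<ge> 1"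
    using t by simp
  ultimately have "1 \<le> exp t * (1 - t + t\<^sup>2)" by linarith
  then have "exp (- t) * 1 \<le> exp (- t) * (exp t * (1 - t + t\<^sup>2))"
    by (intro mult_left_mono) auto
  also have "\<dots> = 1 - t + t\<^sup>2"
    by (simp add: exp_minus)
  finally show ?thesis by (simp add: t_def)
qed

text \<open>The second moment about an arbitrary point \<open>a\<close> may replace the variance,
  since it is at least as large.\<close>

lemma binomial_mean_exp_le:
  assumes p: "p \<in> {0..1}" and g: "\<And>k. k \<le> m \<Longrightarrow> \<bar>g k\<bar> \<le> 1"
    and v: "binomial_mean m p (\<lambda>k. (g k - a)\<^sup>2) \<le> v" and l: "0 \<le> l" "l \<le> 1 / 2"
  shows "binomial_mean m p (\<lambda>k. exp (l * g k)) \<le> exp (l * binomial_mean m p g + l\<^sup>2 * v)"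
proof -
  define \<mu> where "\<mu> = binomial_mean m p g"
  have \<mu>: "\<bar>\<mu>\<bar> \<le> 1" unfolding \<mu>_def by (intro abs_binomial_mean_le p g)
  have "(\<lambda>k. (g k - a)\<^sup>2) = (\<lambda>k. ((g k - \<mu>)\<^sup>2 + (2 * (\<mu> - a)) * (g k - \<mu>)) + (\<mu> - a)\<^sup>2)"
    by (auto simp: power2_eq_square algebra_simps)
  then have e: "binomial_mean m p (\<lambda>k. (g k - a)\<^sup>2) =
      (binomial_mean m p (\<lambda>k. (g k - \<mu>)\<^sup>2) + (2 * (\<mu> - a)) * (binomial_mean m p g - \<mu>)) + (\<mu> - a)\<^sup>2"
    by (simp only: binomial_mean_add binomial_mean_diff binomial_mean_cmult binomial_mean_const)
  have var: "binomial_mean m p (\<lambda>k. (g k - \<mu>)\<^sup>2) \<le> v"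
    using v e \<mu>_def by (smt (verit) mult_eq_0_iff zero_le_power2)
  have "binomial_mean m p (\<lambda>k. exp (l * g k)) \<le>
     binomial_mean m p (\<lambda>k. exp (l * \<mu>) * ((1 + l * (g k - \<mu>)) + l\<^sup>2 * (g k - \<mu>)\<^sup>2))"
  proof (rule binomial_mean_mono[OF p])
    fix k assume k: "k \<le> m"
    have "\<bar>l * (g k - \<mu>)\<bar> = l * \<bar>g k - \<mu>\<bar>" using l by (simp add: abs_mult)
    also have "\<dots> \<le> 1 / 2 * 2" using l g[OF k] \<mu> by (intro mult_mono) auto
    finally have "exp (l * (g k - \<mu>)) \<le> 1 + l * (g k - \<mu>) + (l * (g k - \<mu>))\<^sup>2"
      by (intro exp_le_quadratic) simp
    then have "exp (l * \<mu>) * exp (l * (g k - \<mu>)) \<le> exp (l * \<mu>) * ((1 + l * (g k - \<mu>))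
        + l\<^sup>2 * (g k - \<mu>)\<^sup>2)"
      by (intro mult_left_mono) (auto simp: power_mult_distrib)
    then show "exp (l * g k) \<le> exp (l * \<mu>) * ((1 + l * (g k - \<mu>)) + l\<^sup>2 * (g k - \<mu>)\<^sup>2)"
      by (simp flip: exp_add add: algebra_simps)
  qed
  also have "\<dots> = exp (l * \<mu>) * ((1 + l * (binomial_mean m p g - \<mu>))
      + l\<^sup>2 * binomial_mean m p (\<lambda>k. (g k - \<mu>)\<^sup>2))"
    by (simp only: binomial_mean_add binomial_mean_diff binomial_mean_cmult binomial_mean_const)
  also have "\<dots> \<le> exp (l * \<mu>) * (1 + l\<^sup>2 * v)"
    using var unfolding \<mu>_def[symmetric] by (auto intro!: mult_left_mono)
  also have "\<dots> \<le> exp (l * \<mu>) * exp (l\<^sup>2 * v)"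
    by (intro mult_left_mono exp_ge_add_one_self) auto
  finally show ?thesis by (simp add: exp_add \<mu>_def)
qed

lemma nn_integral_contaminated:
  assumes Q: "Q \<in> distributions" and f: "f \<in> borel_measurable borel"
  shows "(\<integral>\<^sup>+x. f x \<partial>contaminated m \<epsilon> p Q) =
    ennreal (1 - \<epsilon>) * (\<integral>\<^sup>+x. f x \<partial>binomial_law m p) + ennreal \<epsilon> * (\<integral>\<^sup>+x. f x \<partial>Q)"
proof -
  have sQ [measurable_cong]: "sets Q = sets borel" using Q by (simp add: distributions_def)
  have mb: "borel_measurable M = borel_measurable borel" if "sets M = sets borel"
      for M :: "real measure"
    using that by (intro measurable_cong_sets) auto
  have mbs [simp]: "borel_measurable (contaminated m \<epsilon> p Q) = borel_measurable borel"
    "borel_measurable (binomial_law m p) = borel_measurable borel" "borel_measurable Q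
        = borel_measurable borel"
    by (intro mb; simp add: sQ)+
  from f show ?thesis
  proof (induction rule: borel_measurable_induct)
    case (cong f g)
    then have "f = g" by (auto simp: fun_eq_iff)
    with cong show ?case by simp
  next
    case (set A)
    then show ?case using Q by (simp add: emeasure_contaminated sQ)
  next
    case (mult u c)
    then show ?case by (simp add: nn_integral_cmult distrib_left mult_ac)
  next
    case (add u v)
    then show ?case by (simp add: nn_integral_add distrib_left add_ac)
  next
    case (seq U)
    have *: "(\<integral>\<^sup>+x. (SUP i. U i) x \<partial>M) = (SUP i. \<integral>\<^sup>+x. U i x \<partial>M)" if "sets M = sets borel" for M
      unfolding SUP_apply using seq that
      by (intro nn_integral_monotone_convergence_SUP) (auto simp: mb[OF that])
    have inc: "incseq (\<lambda>i. c * (\<integral>\<^sup>+x. U i x \<partial>M))" for M c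
      using seq by (auto simp: incseq_def le_fun_def intro!: mult_left_mono nn_integral_mono)
    have "(\<integral>\<^sup>+x. (SUP i. U i) x \<partial>contaminated m \<epsilon> p Q) = (SUP i. \<integral>\<^sup>+x. U i x \<partial>contaminated m \<epsilon> p Q)"
      by (rule *) simp
    also have "\<dots> = (SUP i. ennreal (1 - \<epsilon>) * (\<integral>\<^sup>+x. U i x \<partial>binomial_law m p)
        + ennreal \<epsilon> * (\<integral>\<^sup>+x. U i x \<partial>Q))"
      by (simp add: seq)
    also have "\<dots> = ennreal (1 - \<epsilon>) * (SUP i. \<integral>\<^sup>+x. U i x \<partial>binomial_law m p)
        + ennreal \<epsilon> * (SUP i. \<integral>\<^sup>+x. U i x \<partial>Q)"
      by (simp add: ennreal_SUP_add[OF inc inc] SUP_mult_left_ennreal)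
    also have "(SUP i. \<integral>\<^sup>+x. U i x \<partial>binomial_law m p) = (\<integral>\<^sup>+x. (SUP i. U i) x \<partial>binomial_law m p)"
      by (rule *[symmetric]) simp
    also have "(SUP i. \<integral>\<^sup>+x. U i x \<partial>Q) = (\<integral>\<^sup>+x. (SUP i. U i) x \<partial>Q)"
      by (rule *[symmetric, OF sQ])
    finally show ?case .
  qed
qed

lemma nn_integral_contaminated_le:
  assumes Q: "Q \<in> distributions" and eps: "\<epsilon> \<in> {0..1}" and p: "p \<in> {0..1}"
    and f: "f \<in> borel_measurable borel" "\<And>x. 0 \<le> f x" "\<And>x. f x \<le> c"
  shows "(\<integral>\<^sup>+x. ennreal (f x) \<partial>contaminated m \<epsilon> p Q) \<le>
    ennreal ((1 - \<epsilon>) * binomial_mean m p (\<lambda>k. f (real k)) + \<epsilon> * c)"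
proof -
  interpret Q: prob_space Q using Q by (simp add: distributions_def)
  have c: "c \<ge> 0" using f(2)[of 0] f(3)[of 0] by linarith
  have m0: "0 \<le> binomial_mean m p (\<lambda>k. f (real k))"
    using binomial_mean_mono[OF p, of m "\<lambda>_. 0" "\<lambda>k. f (real k)"] f by simp
  have "(\<integral>\<^sup>+x. ennreal (f x) \<partial>Q) \<le> (\<integral>\<^sup>+x. ennreal c \<partial>Q)"
    using f by (intro nn_integral_mono) (auto intro: ennreal_leI)
  also have "\<dots> = ennreal c" by (simp add: Q.emeasure_space_1)
  finally have "(\<integral>\<^sup>+x. ennreal (f x) \<partial>contaminated m \<epsilon> p Q) \<le>
     ennreal (1 - \<epsilon>) * ennreal (binomial_mean m p (\<lambda>k. f (real k))) + ennreal \<epsilon> * ennreal c"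
    using f by (subst nn_integral_contaminated[OF Q])
      (auto simp: nn_integral_binomial_law[OF p] intro!: add_mono mult_left_mono)
  also have "\<dots> = ennreal ((1 - \<epsilon>) * binomial_mean m p (\<lambda>k. f (real k)) + \<epsilon> * c)"
    using eps c m0 by (simp add: ennreal_mult'' ennreal_plus)
  finally show ?thesis .
qed

text \<open>Contaminated observations may be arbitrary reals; they are mapped to a count in
  \<open>{0..m}\<close>. Genuine binomial observations are unchanged.\<close>

definition to_count :: "nat \<Rightarrow> real \<Rightarrow> nat" where
  "to_count m x = min m (nat \<lfloor>x\<rfloor>)"

lemma to_count_le: "to_count m x \<le> m"
  by (simp add: to_count_def)

lemma to_count_of_nat [simp]: "k \<le> m \<Longrightarrow> to_count m (real k) = k"
  by (simp add: to_count_def)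

lemma measurable_to_count [measurable]: "to_count m \<in> borel \<rightarrow>\<^sub>M count_space UNIV"
  unfolding to_count_def by measurable

text \<open>A Bernstein-type bound. The contaminating law enters only through the worst case
  \<open>g = 1\<close>, so only the second moment of \<open>g\<close> under the uncontaminated law appears. The two terms
  \<open>sqrt (v \<tau>)\<close> and \<open>\<tau>\<close> of the required drift correspond to the two choices of the exponent \<open>l\<close>.\<close>

lemma score_sum_tail:
  assumes Q: "Q \<in> distributions" and eps: "\<epsilon> \<in> {0..1}" and p: "p \<in> {0..1}"
    and g: "\<And>k. k \<le> m \<Longrightarrow> \<bar>g k\<bar> \<le> 1"
    and v: "binomial_mean m p (\<lambda>k. (g k - a)\<^sup>2) \<le> v" and \<tau>: "\<tau> > 0"
    and drift: "binomial_mean m p g \<le> - (4 * \<epsilon> + 4 * \<tau> + 2 * sqrt (v * \<tau>))"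
  shows "measure (sample_law n m \<epsilon> p Q)
    {x \<in> space (sample_law n m \<epsilon> p Q). 0 \<le> (\<Sum>i<n. g (to_count m (x i)))} \<le> exp (- (real n * \<tau>))"
proof -
  define D where "D = 4 * \<epsilon> + 4 * \<tau> + 2 * sqrt (v * \<tau>)"
  have v0: "v \<ge> 0"
    using binomial_mean_mono[OF p, of m "\<lambda>_. 0" "\<lambda>k. (g k - a)\<^sup>2"] v by simp
  obtain l where l: "0 \<le> l" "l \<le> 1 / 2" "l * D \<ge> l\<^sup>2 * v + 4 * l * \<epsilon> + \<tau>"
  proof (cases "v \<ge> 4 * \<tau>")
    case True
    define l where "l = sqrt (\<tau> / v)"
    have "\<tau> / v \<le> (1 / 2)\<^sup>2" using True \<tau> by (simp add: field_simps power2_eq_square)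
    then have "l \<le> 1 / 2" unfolding l_def by (rule real_le_lsqrt[rotated 1]) (use \<tau> in auto)
    moreover have "l * sqrt (v * \<tau>) = \<tau>" "l\<^sup>2 * v = \<tau>"
      using True \<tau> by (auto simp: l_def simp flip: real_sqrt_mult)
    moreover have "l \<ge> 0" using True \<tau> by (simp add: l_def)
    moreover have "l * D = 4 * l * \<epsilon> + 4 * (l * \<tau>) + 2 * (l * sqrt (v * \<tau>))"
      by (simp add: D_def algebra_simps)
    moreover have "l * \<tau> \<ge> 0" using \<open>l \<ge> 0\<close> \<tau> by simp
    ultimately have "l * D \<ge> l\<^sup>2 * v + 4 * l * \<epsilon> + \<tau>" using \<tau> by linarith
    then show ?thesis using that \<open>l \<ge> 0\<close> \<open>l \<le> 1 / 2\<close> by blast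
  next
    case False
    have "sqrt (v * \<tau>) \<ge> 0" using \<tau> v0 by simp
    with False have "v \<le> 4 * \<tau> + 4 * sqrt (v * \<tau>)" by linarith
    then show ?thesis
      using \<tau> by (intro that[of "1 / 2"]) (auto simp: D_def power2_eq_square)
  qed
  define \<mu> where "\<mu> = binomial_mean m p g"
  have \<mu>: "\<mu> \<le> - D" "\<bar>\<mu>\<bar> \<le> 1"
    using drift abs_binomial_mean_le[OF p g] by (auto simp: \<mu>_def D_def)
  define F where "F = (\<lambda>x. exp (l * g (to_count m x)))"
  have [measurable]: "F \<in> borel_measurable borel" unfolding F_def by measurable
  define N where "N = contaminated m \<epsilon> p Q"
  have sN [measurable_cong, simp]: "sets N = sets borel" by (simp add: N_def)
  interpret N: prob_space N
    using contaminated_distribution[OF Q eps] by (simp add: N_def distributions_def)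
  interpret product_sigma_finite "\<lambda>_::nat. N" ..
  interpret P: prob_space "PiM {..<n} (\<lambda>_. N)" by (intro prob_space_PiM N.prob_space_axioms)
  have "(\<integral>\<^sup>+x. ennreal (F x) \<partial>N) \<le> ennreal ((1 - \<epsilon>) * binomial_mean m p (\<lambda>k. F (real k))
      + \<epsilon> * exp l)"
    unfolding N_def
  proof (rule nn_integral_contaminated_le[OF Q eps p])
    fix x
    have "g (to_count m x) \<le> 1" using g[OF to_count_le[of m x]] by linarith
    then show "F x \<le> exp l" unfolding F_def using l by (simp add: mult_left_le)
  qed (auto simp: F_def)
  also have "(1 - \<epsilon>) * binomial_mean m p (\<lambda>k. F (real k)) + \<epsilon> * exp l \<le> exp (- \<tau>)"
  proof -
    define E where "E = l * \<mu> + l\<^sup>2 * v"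
    have "binomial_mean m p (\<lambda>k. F (real k)) = binomial_mean m p (\<lambda>k. exp (l * g k))"
      by (intro binomial_mean_cong) (simp add: F_def)
    also have "\<dots> \<le> exp E"
      unfolding E_def \<mu>_def by (rule binomial_mean_exp_le[OF p g v]) (use l in auto)
    finally have 1: "(1 - \<epsilon>) * binomial_mean m p (\<lambda>k. F (real k)) \<le> (1 - \<epsilon>) * exp E"
      using eps by (intro mult_left_mono) auto
    have "l * (- 1) \<le> l * \<mu>" using \<mu> l by (intro mult_left_mono) auto
    moreover have "l\<^sup>2 * v \<ge> 0" using v0 by simp
    ultimately have "l \<le> E + 2 * l" by (simp add: E_def)
    then have "\<epsilon> * exp l \<le> \<epsilon> * exp (E + 2 * l)"
      using eps by (intro mult_left_mono) auto
    also have "\<dots> = exp E * (\<epsilon> * exp (2 * l))" by (simp add: exp_add)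
    also have "exp (2 * l) \<le> 1 + 2 * l + (2 * l)\<^sup>2"
      using l by (intro exp_le_quadratic) auto
    also have "(2 * l)\<^sup>2 \<le> 2 * l"
      using l mult_left_mono[of "2 * l" 1 "2 * l"] by (simp add: power2_eq_square)
    finally have "(1 - \<epsilon>) * binomial_mean m p (\<lambda>k. F (real k)) + \<epsilon> * exp l \<le>
        (1 - \<epsilon>) * exp E + exp E * (\<epsilon> * (1 + 2 * l + 2 * l))"
      using 1 eps by (auto simp: mult_left_mono)
    \<comment> \<open>The contamination costs at most a factor \<open>exp (4 l \<epsilon>)\<close>.\<close>
    also have "\<dots> = exp E * (1 + 4 * l * \<epsilon>)" by (simp add: algebra_simps)
    also have "\<dots> \<le> exp E * exp (4 * l * \<epsilon>)"
      by (intro mult_left_mono exp_ge_add_one_self) auto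
    also have "\<dots> \<le> exp (- \<tau>)"
    proof -
      have "l * \<mu> \<le> l * (- D)" using \<mu> l by (intro mult_left_mono) auto
      then show ?thesis using l by (simp add: E_def flip: exp_add)
    qed
    finally show ?thesis .
  qed
  finally have mgf: "(\<integral>\<^sup>+x. ennreal (F x) \<partial>N) \<le> ennreal (exp (- \<tau>))"
    by (simp add: ennreal_leI)
  define A where "A = {x \<in> space (PiM {..<n} (\<lambda>_. N)). 0 \<le> (\<Sum>i<n. g (to_count m (x i)))}"
  have [measurable]: "A \<in> sets (PiM {..<n} (\<lambda>_. N))" unfolding A_def by measurable
  have "emeasure (PiM {..<n} (\<lambda>_. N)) A = (\<integral>\<^sup>+x. indicator A x \<partial>PiM {..<n} (\<lambda>_. N))"
    by simp
  also have "\<dots> \<le> (\<integral>\<^sup>+x. (\<Prod>i<n. ennreal (F (x i))) \<partial>PiM {..<n} (\<lambda>_. N))"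
  proof (rule nn_integral_mono)
    fix x
    have "1 \<le> exp (l * (\<Sum>i<n. g (to_count m (x i))))" if "x \<in> A"
      using that l by (simp add: A_def)
    then have "ennreal 1 \<le> ennreal (\<Prod>i<n. F (x i))" if "x \<in> A"
      using that unfolding F_def by (intro ennreal_leI) (simp add: exp_sum sum_distrib_left)
    then show "indicator A x \<le> (\<Prod>i<n. ennreal (F (x i)))"
      by (auto simp: indicator_def F_def prod_ennreal)
  qed
  also have "\<dots> = (\<Prod>i<n. \<integral>\<^sup>+x. ennreal (F x) \<partial>N)"
    by (rule product_nn_integral_prod) auto
  also have "\<dots> \<le> (\<Prod>i<n. ennreal (exp (- \<tau>)))"
    using mgf by (intro prod_mono_ennreal) auto
  also have "\<dots> = ennreal (exp (- (real n * \<tau>)))"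
    by (simp add: ennreal_power exp_of_nat_mult[symmetric])
  finally have "measure (PiM {..<n} (\<lambda>_. N)) A \<le> exp (- (real n * \<tau>))"
    by (simp add: P.emeasure_eq_measure)
  then show ?thesis unfolding A_def N_def sample_law_def .
qed

section \<open>The sign estimator\<close>

lemma binomial_mean_antitone:
  assumes "q \<in> {0..1}" "q' \<in> {0..1}" "q \<le> q'" "\<And>k. h (Suc k) \<le> h k"
  shows "binomial_mean m q' h \<le> binomial_mean m q h"
  using assms(4)
proof (induction m arbitrary: h)
  case (Suc m)
  define a b a' b' where "a = binomial_mean m q h" and "b = binomial_mean m q (\<lambda>k. h (Suc k))"
    and "a' = binomial_mean m q' h" and "b' = binomial_mean m q' (\<lambda>k. h (Suc k))"
  have 1: "a' \<le> a" "b' \<le> b" using Suc by (auto simp: a_def b_def a'_def b'_def)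
  have "b' \<le> a'" unfolding a'_def b'_def
    using Suc.prems assms by (intro binomial_mean_mono) auto
  then have "(q' - q) * b' \<le> (q' - q) * a'"
    using assms by (intro mult_left_mono) auto
  then have "q' * b' + (1 - q') * a' \<le> q * b' + (1 - q) * a'" by (simp add: algebra_simps)
  also have "\<dots> \<le> q * b + (1 - q) * a"
    using 1 assms by (intro add_mono mult_left_mono) auto
  finally show ?case by (simp add: binomial_mean_Suc a_def b_def a'_def b'_def)
qed simp

lemma abs_sgn_real_le: "\<bar>sgn (x :: real)\<bar> \<le> 1"
  by (simp add: sgn_if)

lemma abs_sign_score_le: "q \<in> {0..1} \<Longrightarrow> \<bar>sign_score m q k\<bar> \<le> 1"
  unfolding sign_score_def by (intro abs_binomial_mean_le abs_sgn_real_le)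

lemma sign_score_antitone:
  assumes "q \<in> {0..1}" "q' \<in> {0..1}" "q \<le> q'"
  shows "sign_score m q' k \<le> sign_score m q k"
  unfolding sign_score_def using assms by (intro binomial_mean_antitone) (auto simp: sgn_if)

lemma sign_score_0_nonneg: "0 \<le> sign_score m 0 k"
proof -
  have "binomial_mean m 0 h = h 0" for h by (induction m) (auto simp: binomial_mean_Suc)
  then show ?thesis by (simp add: sign_score_def sgn_if)
qed

text \<open>Besides the trivial bound, the second moment is small when \<open>m p (1 - p)\<close> is
  small: the observation then almost always equals \<open>0\<close> (or \<open>m\<close>), and \<open>a\<close> is taken to be the score there.
  This is what yields the faster rate near the end points.\<close>

lemma sign_score_second_moment:
  assumes p: "p \<in> {0..1}" and q: "q \<in> {0..1}"
  obtains a where "binomial_mean m p (\<lambda>k. (sign_score m q k - a)\<^sup>2)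
      \<le> min 4 (8 * real m * (p * (1 - p)))"
proof -
  have sq: "x\<^sup>2 \<le> 4" if "\<bar>x\<bar> \<le> 2" for x :: real
    using power_mono[OF that, of 2] by simp
  have d: "(sign_score m q k - sign_score m q j)\<^sup>2 \<le> 4" for j k
    using abs_sign_score_le[OF q, of m k] abs_sign_score_le[OF q, of m j] by (intro sq) linarith
  have "binomial_mean m p (\<lambda>k. (sign_score m q k - sign_score m q j)\<^sup>2) \<le> binomial_mean m p (\<lambda>_. 4)"
      for j
    using d by (intro binomial_mean_mono p)
  then have le4: "binomial_mean m p (\<lambda>k. (sign_score m q k - sign_score m q j)\<^sup>2) \<le> 4" for j by simp
  have "\<exists>j. binomial_mean m p (\<lambda>k. (sign_score m q k - sign_score m q j)\<^sup>2)
      \<le> 8 * real m * (p * (1 - p))"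
  proof (cases "p \<le> 1 / 2")
    case True
    have "binomial_mean m p (\<lambda>k. (sign_score m q k - sign_score m q 0)\<^sup>2)
        \<le> binomial_mean m p (\<lambda>k. 4 * real k)"
    proof (rule binomial_mean_mono[OF p])
      show "(sign_score m q k - sign_score m q 0)\<^sup>2 \<le> 4 * real k" for k
        using d[of k 0] by (cases k) auto
    qed
    also have "\<dots> = 4 * real m * p * 1" by (simp add: binomial_mean_cmult binomial_mean_id)
    also have "\<dots> \<le> 4 * real m * p * (2 * (1 - p))"
      using True p by (intro mult_left_mono) auto
    finally show ?thesis by (intro exI[of _ 0]) (simp add: mult_ac)
  next
    case False
    have "binomial_mean m p (\<lambda>k. (sign_score m q k - sign_score m q m)\<^sup>2)
        \<le> binomial_mean m p (\<lambda>k. 4 * real m - 4 * real k)"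
    proof (rule binomial_mean_mono[OF p])
      show "(sign_score m q k - sign_score m q m)\<^sup>2 \<le> 4 * real m - 4 * real k" if "k \<le> m" for k
        using d[of k m] that by (cases "k = m") auto
    qed
    also have "\<dots> = 4 * real m * (1 - p) * 1"
      unfolding binomial_mean_diff binomial_mean_cmult binomial_mean_id binomial_mean_const
      by (simp add: algebra_simps)
    also have "\<dots> \<le> 4 * real m * (1 - p) * (2 * p)"
      using False p by (intro mult_left_mono) auto
    finally show ?thesis by (intro exI[of _ m]) (simp add: mult_ac)
  qed
  then show ?thesis using le4 that by auto
qed

text \<open>The total score of the sample at the candidate parameter \<open>q\<close>.\<close>

definition score_sum :: "nat \<Rightarrow> nat \<Rightarrow> real \<Rightarrow> (nat \<Rightarrow> real) \<Rightarrow> real" where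
  "score_sum n m q x = (\<Sum>i<n. sign_score m q (to_count m (x i)))"

text \<open>The total score is antitone in \<open>q\<close>; the estimator is the last point of
  \<open>{0..1}\<close> at which it is nonnegative. The set is nonempty because every score is nonnegative at \<open>q = 0\<close>.
  The estimator uses neither \<open>\<epsilon>\<close> nor a confidence level.\<close>

definition sign_estimator :: "nat \<Rightarrow> nat \<Rightarrow> (nat \<Rightarrow> real) \<Rightarrow> real" where
  "sign_estimator n m x = Sup {q \<in> {0..1}. 0 \<le> score_sum n m q x}"

text \<open>By monotonicity, comparing the estimator with a fixed threshold amounts to
  checking the sign of the total score at that threshold; no bound uniform in \<open>q\<close> is needed.\<close>

lemma sign_estimator_props:
  shows sign_estimator_bounds: "sign_estimator n m x \<in> {0..1}"
    and sign_estimator_ge_iff: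
      "0 < c \<Longrightarrow> c \<le> 1 \<Longrightarrow> c \<le> sign_estimator n m x \<longleftrightarrow> 0 \<le> score_sum n m c x"
proof -
  define S where "S = {q \<in> {0..1}. 0 \<le> score_sum n m q x}"
  have "0 \<in> S" by (auto simp: S_def score_sum_def intro: sum_nonneg sign_score_0_nonneg)
  then have ne: "S \<noteq> {}" by blast
  have bdd: "bdd_above S" by (auto simp: S_def intro: bdd_aboveI[of _ 1])
  have "continuous_on {0..1} (\<lambda>q. score_sum n m q x)"
    unfolding score_sum_def sign_score_def by (intro continuous_on_sum continuous_on_binomial_mean)
  then have "closed S"
    using continuous_closed_preimage[of "{0..1}" "\<lambda>q. score_sum n m q x" "{0..}"]
    by (simp add: S_def vimage_def Int_def)
  then have S: "Sup S \<in> S" by (rule closed_contains_Sup[OF ne bdd])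
  then show "sign_estimator n m x \<in> {0..1}" by (simp add: sign_estimator_def S_def)
  assume c: "0 < c" "c \<le> 1"
  have "0 \<le> score_sum n m c x" if "c \<le> Sup S"
  proof -
    have "score_sum n m (Sup S) x \<le> score_sum n m c x"
      unfolding score_sum_def using that c S
      by (intro sum_mono sign_score_antitone) (auto simp: S_def)
    then show ?thesis using S by (simp add: S_def)
  qed
  moreover have "c \<le> Sup S" if "0 \<le> score_sum n m c x"
    using that c by (intro cSup_upper[OF _ bdd]) (auto simp: S_def)
  ultimately show "c \<le> sign_estimator n m x \<longleftrightarrow> 0 \<le> score_sum n m c x"
    by (auto simp: sign_estimator_def S_def)
qed

lemma measurable_score_sum [measurable]:
  "score_sum n m q \<in> borel_measurable (PiM {..<n} (\<lambda>_. borel))"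
  unfolding score_sum_def by measurable

lemma sign_estimator_measurable: "sign_estimator n m \<in> estimators n"
  unfolding estimators_def borel_measurable_iff_ge
proof
  fix a :: real
  let ?M = "PiM {..<n} (\<lambda>_. borel :: real measure)"
  consider "a \<le> 0" | "0 < a" "a \<le> 1" | "1 < a" by linarith
  then show "{x \<in> space ?M. a \<le> sign_estimator n m x} \<in> sets ?M"
  proof cases
    case 1
    then have "{x \<in> space ?M. a \<le> sign_estimator n m x} = space ?M"
      using sign_estimator_bounds[of n m] by (auto intro: order_trans)
    then show ?thesis by simp
  next
    case 2
    then have "{x \<in> space ?M. a \<le> sign_estimator n m x} = {x \<in> space ?M. 0 \<le> score_sum n m a x}"
      by (simp add: sign_estimator_ge_iff)
    also have "\<dots> \<in> sets ?M" by measurable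
    finally show ?thesis .
  next
    case 3
    then have "\<not> a \<le> sign_estimator n m x" for x
      using sign_estimator_bounds[of n m x] by auto
    then show ?thesis by simp
  qed
qed

text \<open>The radius \<open>r\<close> is chosen such that the linear lower bound on the drift of the score
  at \<open>p + r\<close> and at \<open>p - r\<close> equals the drift \<open>D\<close> that the tail bound asks for; \<open>288 D \<le> 1\<close> keeps both
  points within the range in which the linear bound holds.\<close>

lemma sign_estimator_accuracy:
  fixes \<epsilon> p \<tau> :: real and n m :: nat
  assumes Q: "Q \<in> distributions" and eps: "\<epsilon> \<in> {0..1}" and p: "p \<in> {0..1}"
    and m: "m \<ge> 1" and \<tau>: "\<tau> > 0"
  defines "D \<equiv> 4 * \<epsilon> + 4 * \<tau> + 2 * sqrt (min 4 (8 * real m * (p * (1 - p))) * \<tau>)"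
  defines "r \<equiv> 36 * (1 + sqrt (real m * (p * (1 - p)))) * D / real m"
  assumes small: "288 * D \<le> 1"
  shows "measure (sample_law n m \<epsilon> p Q)
    {x \<in> space (sample_law n m \<epsilon> p Q). \<bar>sign_estimator n m x - p\<bar>
        \<le> r} \<ge> 1 - 2 * exp (- (real n * \<tau>))"
proof -
  define N where "N = sample_law n m \<epsilon> p Q"
  define s where "s = 1 + sqrt (real m * (p * (1 - p)))"
  interpret N: prob_space N unfolding N_def by (rule prob_space_sample_law[OF Q eps])
  have sN [measurable_cong]: "sets N = sets (PiM {..<n} (\<lambda>_. borel))"
    unfolding N_def sample_law_def by (intro sets_PiM_cong) auto
  have [measurable]: "sign_estimator n m \<in> borel_measurable N"
    using sign_estimator_measurable[of n m] measurable_cong_sets[OF sN refl]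
    unfolding estimators_def by blast
  have [measurable]: "score_sum n m q \<in> borel_measurable N" for q
    using measurable_score_sum[of n m q] measurable_cong_sets[OF sN refl] by blast
  have "0 \<le> sqrt (min 4 (8 * real m * (p * (1 - p))) * \<tau>)" using \<tau> p by simp
  moreover have "0 \<le> \<epsilon>" using eps by simp
  ultimately have D: "D > 0" unfolding D_def using \<tau> by linarith
  have s: "s \<ge> 1" using p by (simp add: s_def)
  have r: "r > 0" unfolding r_def s_def[symmetric] using D s m
      by (auto intro!: divide_pos_pos mult_pos_pos)
  have r_eq: "real m * r / (36 * s) = D"
    unfolding r_def s_def[symmetric] using s m by (simp add: field_simps)
  have "r = s * (288 * D) / (8 * real m)"
    unfolding r_def s_def[symmetric] by simp
  also have "\<dots> \<le> s * 1 / (8 * real m)"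
    using small s by (intro divide_right_mono mult_left_mono) auto
  finally have r_le: "r \<le> s / (8 * real m)" by simp
  define U where "U = {x \<in> space N. p + r \<le> 1 \<and> 0 \<le> score_sum n m (p + r) x}"
  define L where "L = {x \<in> space N. 0 \<le> p - r \<and> 0 \<le> - score_sum n m (p - r) x}"
  have [measurable]: "U \<in> sets N" "L \<in> sets N" unfolding U_def L_def by measurable
  have U: "measure N U \<le> exp (- (real n * \<tau>))"
  proof (cases "p + r \<le> 1")
    case True
    then have q: "p + r \<in> {0..1}" using p r by auto
    obtain a where a: "binomial_mean m p (\<lambda>k. (sign_score m (p + r) k - a)\<^sup>2)
        \<le> min 4 (8 * real m * (p * (1 - p)))"
      using sign_score_second_moment[OF p q] by blast
    have "binomial_mean m p (sign_score m (p + r)) \<le> - (real m * (p + r - p) / (36 * s))"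
      unfolding s_def by (rule sign_mean_ge(1)[OF p q m]) (use r r_le in \<open>auto simp: s_def\<close>)
    then have "binomial_mean m p (sign_score m (p + r)) \<le> - D" using r_eq by simp
    then show ?thesis
      using score_sum_tail[OF Q eps p abs_sign_score_le[OF q] a \<tau>, of n] True
      by (simp add: U_def N_def D_def score_sum_def)
  next
    case False
    then show ?thesis by (simp add: U_def)
  qed
  have L: "measure N L \<le> exp (- (real n * \<tau>))"
  proof (cases "0 \<le> p - r")
    case True
    then have q: "p - r \<in> {0..1}" using p r by auto
    obtain a where a: "binomial_mean m p (\<lambda>k. (sign_score m (p - r) k - a)\<^sup>2)
        \<le> min 4 (8 * real m * (p * (1 - p)))"
      using sign_score_second_moment[OF p q] by blast
    have "(\<lambda>k. (- sign_score m (p - r) k - (- a))\<^sup>2) = (\<lambda>k. (sign_score m (p - r) k - a)\<^sup>2)"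
      by (auto simp: power2_commute)
    with a have a': "binomial_mean m p (\<lambda>k. (- sign_score m (p - r) k - (- a))\<^sup>2)
        \<le> min 4 (8 * real m * (p * (1 - p)))"
      by simp
    have "binomial_mean m p (sign_score m (p - r)) \<ge> real m * (p - (p - r)) / (36 * s)"
      unfolding s_def by (rule sign_mean_ge(2)[OF p q m]) (use r r_le in \<open>auto simp: s_def\<close>)
    then have "binomial_mean m p (\<lambda>k. - sign_score m (p - r) k) \<le> - D"
      using r_eq by (simp add: binomial_mean_uminus)
    moreover have "\<bar>- sign_score m (p - r) k\<bar> \<le> 1" for k
      using abs_sign_score_le[OF q] by simp
    ultimately show ?thesis
      using score_sum_tail[OF Q eps p _ a' \<tau>, of n] True
      by (simp add: L_def N_def D_def score_sum_def sum_negf)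
  next
    case False
    then show ?thesis by (simp add: L_def)
  qed
  let ?G = "{x \<in> space N. \<bar>sign_estimator n m x - p\<bar> \<le> r}"
  have "space N - ?G \<subseteq> U \<union> L"
  proof
    fix x assume x: "x \<in> space N - ?G"
    have b: "0 \<le> sign_estimator n m x" "sign_estimator n m x \<le> 1"
      using sign_estimator_bounds[of n m x] by auto
    have "sign_estimator n m x > p + r \<or> sign_estimator n m x < p - r" using x by auto
    then show "x \<in> U \<union> L"
    proof
      assume *: "sign_estimator n m x > p + r"
      then have "p + r \<le> 1" "0 < p + r" using b r p by auto
      then show ?thesis using * x sign_estimator_ge_iff[of "p + r" n m x] by (auto simp: U_def)
    next
      assume *: "sign_estimator n m x < p - r"
      then have "p - r \<le> 1" "0 < p - r" using b r p by auto
      then show ?thesis using * x sign_estimator_ge_iff[of "p - r" n m x] by (auto simp: L_def)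
    qed
  qed
  then have "measure N (space N - ?G) \<le> measure N (U \<union> L)"
    by (intro N.finite_measure_mono) auto
  also have "\<dots> \<le> measure N U + measure N L"
    by (intro measure_Un_le) auto
  also have "\<dots> \<le> 2 * exp (- (real n * \<tau>))" using U L by simp
  finally have "1 - measure N ?G \<le> 2 * exp (- (real n * \<tau>))"
    by (subst (asm) N.prob_compl) auto
  then show ?thesis by (simp add: N_def)
qed

text \<open>The factor \<open>D\<close> is bounded in two ways: with the trivial bound on the second moment
  when it multiplies the standard deviation, and with the bound \<open>8 m p (1 - p)\<close> in the remaining
  term. The constant \<open>1 / 4000000\<close> makes \<open>sqrt \<tau>\<close> at most \<open>1 / 2000\<close>, hence \<open>D\<close> at most \<open>1 / 288\<close>.\<close>

lemma accuracy_le_rate: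
  fixes \<epsilon> p t :: real and n m :: nat
  assumes eps: "\<epsilon> \<in> {0..1}" and p: "p \<in> {0..1}" and n: "n \<ge> 1" and m: "m \<ge> 1" and t: "t > 0"
  defines "\<tau> \<equiv> t / real n"
  defines "D \<equiv> 4 * \<epsilon> + 4 * \<tau> + 2 * sqrt (min 4 (8 * real m * (p * (1 - p))) * \<tau>)"
  assumes small: "\<tau> + \<epsilon> \<le> 1 / 4000000"
  shows "288 * D \<le> 1"
    and "36 * (1 + sqrt (real m * (p * (1 - p)))) * D / real m \<le> (504 * (1 + sqrt t
        + t)) * rate n m \<epsilon> p"
proof -
  define w where "w = p * (1 - p)"
  have w: "w \<ge> 0" using p by (simp add: w_def)
  have \<tau>0: "\<tau> > 0" "\<epsilon> \<ge> 0" using t n eps by (auto simp: \<tau>_def)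
  then have \<tau>: "\<tau> > 0" "\<epsilon> \<ge> 0" "\<tau> \<le> 1 / 4000000" "\<epsilon> \<le> 1 / 4000000"
    using small by linarith+
  have st: "sqrt \<tau> \<le> 1 / 2000"
    using \<tau> by (intro real_le_lsqrt) (auto simp: power2_eq_square)
  have t2: "\<tau> \<le> sqrt \<tau>"
  proof -
    have "sqrt \<tau> * sqrt \<tau> \<le> sqrt \<tau> * 1" using st \<tau> by (intro mult_left_mono) auto
    then show ?thesis using \<tau> by simp
  qed
  have "sqrt (min 4 (8 * real m * w) * \<tau>) \<le> sqrt (4 * \<tau>)"
    using \<tau> by (intro real_sqrt_le_mono mult_right_mono) auto
  also have "\<dots> = 2 * sqrt \<tau>" by (simp add: real_sqrt_mult)
  finally have D1: "D \<le> 4 * \<epsilon> + 4 * \<tau> + 4 * sqrt \<tau>" unfolding D_def w_def[symmetric] by simp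
  then show "288 * D \<le> 1" using \<tau> st by simp
  define y where "y = sqrt (w / real m)"
  have y: "y \<ge> 0" using w by (simp add: y_def)
  have my: "sqrt (real m * w) = real m * y"
    using m by (simp add: y_def real_sqrt_mult real_sqrt_divide field_simps flip: power2_eq_square)
  have "sqrt (min 4 (8 * real m * w) * \<tau>) \<le> sqrt (9 * (real m * w) * \<tau>)"
    using \<tau> w by (intro real_sqrt_le_mono mult_right_mono) (auto simp: min_le_iff_disj)
  also have "\<dots> = 3 * (real m * y) * sqrt \<tau>"
    unfolding my[symmetric] by (simp add: real_sqrt_mult)
  finally have D2: "D \<le> 4 * \<epsilon> + 4 * \<tau> + 6 * (real m * y) * sqrt \<tau>"
    unfolding D_def w_def[symmetric] by linarith
  define R where "R = 1 / sqrt (real n)"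
  define K where "K = 1 + sqrt t + t"
  have R: "R > 0" "sqrt \<tau> = sqrt t * R" using n by (auto simp: R_def \<tau>_def real_sqrt_divide)
  have K: "K \<ge> 1" "sqrt t \<le> K" "t \<le> K" "sqrt t \<ge> 0" using t by (auto simp: K_def)
  have sK: "sqrt \<tau> \<le> K * R" unfolding R using K R by (intro mult_right_mono) auto
  have eK: "\<epsilon> \<le> K * \<epsilon>" using K \<tau> by (simp add: mult_le_cancel_right1)
  have tK: "\<tau> \<le> K * (1 / real n)" using K n by (simp add: \<tau>_def divide_right_mono)
  have "36 * (1 + sqrt (real m * w)) * D / real m = 36 * (D / real m) + 36 * y * D"
    unfolding my using m by (simp add: field_simps)
  also have "\<dots> \<le> 36 * (4 * K * (1 / real m * (1 / real n + \<epsilon>)) + 6 * K * (y * (R + \<epsilon>)))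
      + 36 * (8 * K * (y * (R + \<epsilon>)))"
  proof (rule add_mono)
    have "D / real m \<le> (4 * \<epsilon> + 4 * \<tau> + 6 * (real m * y) * sqrt \<tau>) / real m"
      using D2 by (intro divide_right_mono) auto
    also have "\<dots> = 4 * (1 / real m * (\<tau> + \<epsilon>)) + 6 * (y * sqrt \<tau>)"
      using m by (simp add: field_simps)
    also have "\<dots> \<le> 4 * (1 / real m * (K * (1 / real n) + K * \<epsilon>)) + 6 * (y * (K * R + K * \<epsilon>))"
      using tK eK sK y \<tau> K by (intro add_mono mult_left_mono) auto
    also have "\<dots> = 4 * K * (1 / real m * (1 / real n + \<epsilon>)) + 6 * K * (y * (R + \<epsilon>))"
      by (simp add: algebra_simps)
    finally show "36 * (D / real m) \<le> 36 * (4 * K * (1 / real m * (1 / real n + \<epsilon>))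
        + 6 * K * (y * (R + \<epsilon>)))"
      by simp
    have "D \<le> 8 * (K * R + K * \<epsilon>)" using D1 t2 sK eK \<tau> by simp
    then have "y * D \<le> y * (8 * (K * R + K * \<epsilon>))" using y by (intro mult_left_mono) auto
    then show "36 * y * D \<le> 36 * (8 * K * (y * (R + \<epsilon>)))" by (simp add: algebra_simps)
  qed
  also have "\<dots> \<le> 504 * K * (y * (R + \<epsilon>)) + 504 * K * (1 / real m * (1 / real n + \<epsilon>))"
  proof -
    have aux: "36 * (4 * K * Z + 6 * K * X) + 36 * (8 * K * X) \<le> 504 * K * X + 504 * K * Z"
        if "Z \<ge> 0" for X Z :: real
    proof -
      have "K * Z \<ge> 0" using that K by simp
      then show ?thesis by (simp add: algebra_simps)
    qed
    show ?thesis by (rule aux) (use \<tau> in simp)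
  qed
  also have "\<dots> = (504 * (1 + sqrt t + t)) * rate n m \<epsilon> p"
    by (simp add: rate_def K_def y_def w_def R_def algebra_simps)
  finally show "36 * (1 + sqrt (real m * (p * (1 - p)))) * D / real m \<le> (504 * (1 + sqrt t
      + t)) * rate n m \<epsilon> p"
    unfolding w_def .
qed

lemma estimation_upper_bound:
  fixes \<alpha> :: real
  assumes \<alpha>: "0 < \<alpha>" "\<alpha> < 1" and n: "n \<ge> 1" and m: "m \<ge> 1" and eps: "\<epsilon> \<in> {0..1}"
    and small: "ln (2 / \<alpha>) / real n + \<epsilon> \<le> 1 / 4000000"
  shows "(INF (p, Q) \<in> {0..1} \<times> distributions. \<P>(x in sample_law n m \<epsilon> p Q.
      \<bar>sign_estimator n m x - p\<bar> \<le> (504 * (1 + sqrt (ln (2 / \<alpha>))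
          + ln (2 / \<alpha>))) * rate n m \<epsilon> p)) \<ge> 1 - \<alpha>"
proof (rule cINF_greatest)
  show "{0..1} \<times> distributions \<noteq> ({} :: (real \<times> real measure) set)"
    using binomial_law_distribution by fastforce
  fix z :: "real \<times> real measure" assume "z \<in> {0..1} \<times> distributions"
  then obtain p Q where z: "z = (p, Q)" and p: "p \<in> {0..1}" and Q: "Q \<in> distributions" by auto
  define t where "t = ln (2 / \<alpha>)"
  have t: "t > 0" using \<alpha> by (simp add: t_def)
  define \<tau> where "\<tau> = t / real n"
  have \<tau>: "\<tau> > 0" using t n by (simp add: \<tau>_def)
  define N where "N = sample_law n m \<epsilon> p Q"
  interpret N: prob_space N unfolding N_def by (rule prob_space_sample_law[OF Q eps])
  have sN [measurable_cong]: "sets N = sets (PiM {..<n} (\<lambda>_. borel))"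
    unfolding N_def sample_law_def by (intro sets_PiM_cong) auto
  have [measurable]: "sign_estimator n m \<in> borel_measurable N"
    using sign_estimator_measurable[of n m] measurable_cong_sets[OF sN refl]
    unfolding estimators_def by blast
  note ar = accuracy_le_rate[OF eps p n m t small[folded t_def]]
  have "real n * \<tau> = t" using n by (simp add: \<tau>_def)
  then have "2 * exp (- (real n * \<tau>)) = \<alpha>" using \<alpha> by (simp add: t_def exp_minus)
  then have "1 - \<alpha> \<le> measure N {x \<in> space N. \<bar>sign_estimator n m x - p\<bar> \<le>
      36 * (1 + sqrt (real m * (p * (1 - p)))) * (4 * \<epsilon> + 4 * \<tau>
          + 2 * sqrt (min 4 (8 * real m * (p * (1 - p))) * \<tau>)) / real m}"
    using sign_estimator_accuracy[OF Q eps p m \<tau>, of n] ar(1) unfolding N_def \<tau>_def by simp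
  also have "\<dots> \<le> measure N {x \<in> space N. \<bar>sign_estimator n m x - p\<bar> \<le> (504 * (1 + sqrt t
      + t)) * rate n m \<epsilon> p}"
    using ar(2) by (intro N.finite_measure_mono) (auto simp: \<tau>_def intro: order_trans)
  finally show "1 - \<alpha> \<le> (case z of (p, Q) \<Rightarrow> \<P>(x in sample_law n m \<epsilon> p Q.
      \<bar>sign_estimator n m x - p\<bar> \<le> (504 * (1 + sqrt (ln (2 / \<alpha>)) + ln (2 / \<alpha>))) * rate n m \<epsilon> p))"
    by (simp add: z N_def t_def)
qed

section \<open>Two-point lower bounds\<close>

lemma sample_prob_le_worst_case:
  assumes "\<epsilon> \<in> {0..1}" "\<theta> \<in> {p, q}" "Q \<in> distributions"
  shows "\<P>(x in sample_law n m \<epsilon> \<theta> Q. \<bar>phat x - \<theta>\<bar> \<ge> r) \<le> worst_case_error n m \<epsilon> p q r phat"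
proof -
  have "bdd_above ((\<lambda>(\<theta>, Q). \<P>(x in sample_law n m \<epsilon> \<theta> Q. \<bar>phat x - \<theta>\<bar> \<ge> r))
      ` ({p, q} \<times> distributions))"
    using assms by (intro bdd_aboveI[of _ 1])
      (auto intro!: prob_space.prob_le_1 prob_space_sample_law)
  then show ?thesis
    unfolding worst_case_error_def using assms
    by (intro cSUP_upper2[where x = "(\<theta>, Q)"]) auto
qed

lemma worst_case_error_eq_0:
  assumes "p \<in> {0..1}" "q \<in> {0..1}"
  shows "worst_case_error n m \<epsilon> p q 2 (\<lambda>_. p) = 0"
proof -
  have "(\<lambda>(\<theta>, Q). \<P>(x in sample_law n m \<epsilon> \<theta> Q. \<bar>p - \<theta>\<bar> \<ge> 2)) z = 0" if "z \<in> {p, q} \<times> distributions"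
      for z
  proof -
    have "\<not> 2 \<le> \<bar>p - \<theta>\<bar>" if "\<theta> \<in> {p, q}" for \<theta> using assms that by auto
    with that show ?thesis by (auto split: prod.splits)
  qed
  moreover have "{p, q} \<times> distributions \<noteq> {}" using binomial_law_distribution by blast
  ultimately show ?thesis
    unfolding worst_case_error_def by (metis (no_types, lifting) SUP_cong cSUP_const)
qed

text \<open>The two-point method: if \<open>\<theta> = p\<close> and \<open>\<theta> = q\<close> are compatible with sample laws that
  no event distinguishes by more than \<open>1 / 3\<close>, then for a radius of at most half the gap the two error
  probabilities add up to at least \<open>2 / 3\<close>, so the larger one is at least \<open>1 / 3 > \<alpha>\<close>.\<close>

lemma est_error_ge_half_gap:
  assumes \<alpha>: "0 \<le> \<alpha>" "\<alpha> < 1 / 3" and eps: "\<epsilon> \<in> {0..1}" and pq: "p \<in> {0..1}" "q \<in> {0..1}"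
    and Q: "Q \<in> distributions" "Q' \<in> distributions"
    and close: "\<And>A. A \<in> sets (PiM {..<n} (\<lambda>_. borel)) \<Longrightarrow>
      measure (sample_law n m \<epsilon> q Q') A \<le> measure (sample_law n m \<epsilon> p Q) A + 1 / 3"
  shows "est_error n m \<alpha> \<epsilon> p \<ge> \<bar>p - q\<bar> / 2"
proof -
  define M where "M = sample_law n m \<epsilon> p Q"
  define M' where "M' = sample_law n m \<epsilon> q Q'"
  interpret M: prob_space M unfolding M_def by (rule prob_space_sample_law[OF Q(1) eps])
  interpret M': prob_space M' unfolding M'_def by (rule prob_space_sample_law[OF Q(2) eps])
  have sM: "sets M = sets (PiM {..<n} (\<lambda>_. borel))" "sets M' = sets (PiM {..<n} (\<lambda>_. borel))"
    unfolding M_def M'_def sample_law_def by (intro sets_PiM_cong; simp)+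
  have spM: "space M' = space M" using sM by (intro sets_eq_imp_space_eq) simp
  have third: "1 / 3 \<le> worst_case_error n m \<epsilon> p q r phat"
    if r: "r \<le> \<bar>p - q\<bar> / 2" and phat: "phat \<in> estimators n" for r phat
  proof -
    have [measurable]: "phat \<in> borel_measurable M" "phat \<in> borel_measurable M'"
      using phat measurable_cong_sets[OF sM(1) refl] measurable_cong_sets[OF sM(2) refl]
      by (auto simp: estimators_def)
    define A where "A = {x \<in> space M. \<bar>phat x - p\<bar> \<ge> r}"
    define B where "B = {x \<in> space M'. \<bar>phat x - q\<bar> \<ge> r}"
    have A: "A \<in> sets M" and B: "B \<in> sets M'" unfolding A_def B_def by measurable
    \<comment> \<open>An estimate cannot be closer than \<open>r\<close> to both parameters.\<close>
    have "space M' - A \<subseteq> B"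
      using r by (auto simp: A_def B_def spM)
    then have "measure M' (space M' - A) \<le> measure M' B"
      by (intro M'.finite_measure_mono B)
    moreover have "measure M' (space M' - A) = 1 - measure M' A"
      using A sM by (intro M'.prob_compl) simp
    moreover have "measure M' A \<le> measure M A + 1 / 3"
      unfolding M_def M'_def using A sM by (intro close) simp
    moreover have "measure M A \<le> worst_case_error n m \<epsilon> p q r phat"
      unfolding A_def M_def using sample_prob_le_worst_case[OF eps _ Q(1)] by simp
    moreover have "measure M' B \<le> worst_case_error n m \<epsilon> p q r phat"
      unfolding B_def M'_def using sample_prob_le_worst_case[OF eps _ Q(2)] by simp
    ultimately show ?thesis by linarith
  qed
  have const: "(\<lambda>_. p) \<in> estimators n" by (simp add: estimators_def)
  let ?S = "{r. r \<ge> 0 \<and> (INF phat \<in> estimators n. worst_case_error n m \<epsilon> p q r phat) \<le> \<alpha>}"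
  have "\<bar>p - q\<bar> / 2 \<le> Inf ?S"
  proof (rule cInf_greatest)
    have "0 \<le> worst_case_error n m \<epsilon> p q r phat" for r phat
      using sample_prob_le_worst_case[OF eps _ Q(1), where \<theta> = p and p = p and q = q and n = n
        and m = m and phat = phat and r = r]
      by (meson insertI1 measure_nonneg order_trans)
    then have "(INF phat \<in> estimators n. worst_case_error n m \<epsilon> p q 2 phat)
        \<le> worst_case_error n m \<epsilon> p q 2 (\<lambda>_. p)"
      by (intro cINF_lower const bdd_belowI[of _ 0]) auto
    then have "2 \<in> ?S" using worst_case_error_eq_0[OF pq] \<alpha> by simp
    then show "?S \<noteq> {}" by blast
    fix r assume r: "r \<in> ?S"
    show "\<bar>p - q\<bar> / 2 \<le> r"
    proof (rule ccontr)
      assume "\<not> \<bar>p - q\<bar> / 2 \<le> r"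
      then have "1 / 3 \<le> (INF phat \<in> estimators n. worst_case_error n m \<epsilon> p q r phat)"
        using const by (intro cINF_greatest third) auto
      then show False using r \<alpha> by auto
    qed
  qed
  also have "Inf ?S \<le> est_error n m \<alpha> \<epsilon> p"
    unfolding est_error_pair_def[symmetric] est_error_def
    using est_error_pair_le_1[OF \<alpha>(1) eps pq(1)] pq
    by (intro cSUP_upper bdd_aboveI[of _ 1]) auto
  finally show ?thesis .
qed

lemma est_error_nonneg:
  assumes "0 \<le> \<alpha>" "\<alpha> < 1 / 3" "\<epsilon> \<in> {0..1}" "p \<in> {0..1}"
  shows "0 \<le> est_error n m \<alpha> \<epsilon> p"
  using est_error_ge_half_gap[OF assms assms(4) binomial_law_distribution[of 0 0]
    binomial_law_distribution[of 0 0]] by simp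

lemma finite_law_exists:
  fixes h :: "nat \<Rightarrow> real"
  assumes h: "\<And>k. 0 \<le> h k" and sum: "(\<Sum>k\<le>m. h k) = 1"
  obtains Q where "Q \<in> distributions"
    "\<And>A. A \<in> sets borel \<Longrightarrow> emeasure Q A = ennreal (\<Sum>k\<le>m. h k * indicator A (real k))"
proof -
  define f where "f = (\<lambda>k. if k \<le> m then h k else 0)"
  have pmf: "pmf (embed_pmf f) k = f k" for k
  proof (rule pmf_embed_pmf)
    have "(\<integral>\<^sup>+k. ennreal (f k) \<partial>count_space UNIV) = (\<Sum>k\<le>m. ennreal (f k))"
      by (intro nn_integral_count_space'[where A = "{..m}"]) (auto simp: f_def)
    also have "\<dots> = 1" using h sum by (simp add: f_def)
    finally show "(\<integral>\<^sup>+k. ennreal (f k) \<partial>count_space UNIV) = 1" .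
  qed (use h in \<open>auto simp: f_def\<close>)
  show ?thesis
  proof (rule that[of "distr (measure_pmf (embed_pmf f)) borel real"])
    show "distr (measure_pmf (embed_pmf f)) borel real \<in> distributions"
      unfolding distributions_def
      by (auto intro!: prob_space.prob_space_distr measure_pmf.prob_space_axioms)
    fix A :: "real set" assume A: "A \<in> sets borel"
    have sup: "k \<le> m" if "k \<in> set_pmf (embed_pmf f)" for k
      using that by (simp add: set_pmf_iff pmf) (simp add: f_def split: if_splits)
    have "measure (measure_pmf (embed_pmf f)) (real -` A) = (\<integral>k. indicator (real -` A) k
        \<partial>measure_pmf (embed_pmf f))"
      by simp
    also have "\<dots> = (\<Sum>k\<le>m. indicator (real -` A) k * pmf (embed_pmf f) k)"
      by (rule integral_measure_pmf_real) (auto dest: sup)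
    also have "\<dots> = (\<Sum>k\<le>m. h k * indicator A (real k))"
      by (intro sum.cong refl) (simp add: pmf, simp add: f_def indicator_def)
    finally show "emeasure (distr (measure_pmf (embed_pmf f)) borel real) A
        = ennreal (\<Sum>k\<le>m. h k * indicator A (real k))"
      using A by (simp add: emeasure_distr measure_pmf.emeasure_eq_measure)
  qed
qed

text \<open>The total variation distance of \<open>Binomial(m, p)\<close> and \<open>Binomial(m, q)\<close>, written
  as the mass of the positive part of the difference.\<close>

definition binomial_tv :: "nat \<Rightarrow> real \<Rightarrow> real \<Rightarrow> real" where
  "binomial_tv m p q = (\<Sum>k\<le>m. max 0 (binomial_weight m q k - binomial_weight m p k))"

lemma binomial_tv_commute: "binomial_tv m p q = binomial_tv m q p"
proof -
  have "binomial_tv m p q - binomial_tv m q p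
      = (\<Sum>k\<le>m. binomial_weight m q k - binomial_weight m p k)"
    unfolding binomial_tv_def sum_subtractf[symmetric] by (intro sum.cong) auto
  also have "\<dots> = 0" by (simp add: sum_subtractf sum_binomial_weight)
  finally show ?thesis by simp
qed

lemma binomial_tv_nonneg: "0 \<le> binomial_tv m p q"
  unfolding binomial_tv_def by (intro sum_nonneg) auto

lemma binomial_tv_le_lipschitz:
  assumes "p \<in> {0..1}" "q \<in> {0..1}"
  shows "binomial_tv m p q \<le> real m * \<bar>p - q\<bar>"
proof -
  define h :: "nat \<Rightarrow> real" where "h = (\<lambda>k.
      if binomial_weight m p k < binomial_weight m q k then 1 else 0)"
  have h: "0 \<le> h k" "h k \<le> 1" for k by (auto simp: h_def)
  have "binomial_tv m p q = binomial_mean m q h - binomial_mean m p h"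
    unfolding binomial_tv_def binomial_mean_def sum_subtractf[symmetric]
    by (intro sum.cong) (auto simp: h_def)
  also have "\<dots> \<le> real m * \<bar>p - q\<bar>"
    using binomial_mean_lipschitz[of p q h m, OF assms h] by linarith
  finally show ?thesis .
qed

lemma binomial_tv_le_chi_square:
  assumes p: "p \<in> {0..1}" and q: "0 < q" "q < 1"
  shows "(binomial_tv m p q)\<^sup>2 \<le> (1 + (p - q)\<^sup>2 / (q * (1 - q))) ^ m - 1"
proof -
  define f g where "f = binomial_weight m p" and "g = binomial_weight m q"
  have g: "g k > 0" if "k \<le> m" for k using binomial_weight_pos[OF q that] by (simp add: g_def)
  have "binomial_tv m p q \<le> (\<Sum>k\<le>m. \<bar>g k - f k\<bar>)"
    unfolding binomial_tv_def f_def g_def by (intro sum_mono) auto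
  also have "\<dots> = (\<Sum>k\<le>m. sqrt (g k) * (\<bar>g k - f k\<bar> / sqrt (g k)))"
    by (intro sum.cong) (auto dest: g)
  finally have "(binomial_tv m p q)\<^sup>2 \<le> (\<Sum>k\<le>m. sqrt (g k) * (\<bar>g k - f k\<bar> / sqrt (g k)))\<^sup>2"
    by (intro power_mono binomial_tv_nonneg)
  also have "\<dots> \<le> (\<Sum>k\<le>m. (sqrt (g k))\<^sup>2) * (\<Sum>k\<le>m. (\<bar>g k - f k\<bar> / sqrt (g k))\<^sup>2)"
    by (rule Cauchy_Schwarz_ineq_sum)
  also have "(\<Sum>k\<le>m. (sqrt (g k))\<^sup>2) = (\<Sum>k\<le>m. g k)"
    by (intro sum.cong) (auto dest!: g)
  also have "(\<Sum>k\<le>m. g k) = 1" by (simp add: g_def sum_binomial_weight)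
  also have "(\<Sum>k\<le>m. (\<bar>g k - f k\<bar> / sqrt (g k))\<^sup>2) = (\<Sum>k\<le>m. (g k - 2 * f k) + (f k)\<^sup>2 / g k)"
  proof (intro sum.cong refl)
    fix k assume "k \<in> {..m}"
    then have "g k > 0" using g by simp
    then show "(\<bar>g k - f k\<bar> / sqrt (g k))\<^sup>2 = (g k - 2 * f k) + (f k)\<^sup>2 / g k"
      by (simp add: power_divide field_simps power2_eq_square)
  qed
  also have "\<dots> = (1 + (p - q)\<^sup>2 / (q * (1 - q))) ^ m - 1"
    using chi_square_binomial[OF q, of m p] sum_binomial_weight[of m p] sum_binomial_weight[of m q]
    by (simp add: sum.distrib sum_subtractf f_def g_def flip: sum_distrib_left)
  finally show ?thesis by simp
qed

text \<open>Binomial laws within total variation distance \<open>\<epsilon>\<close> can be contaminated so as to become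
  indistinguishable: both mixtures have density \<open>(1 - \<epsilon>) max f g\<close> plus a common multiple of \<open>f\<close>, where
  \<open>f\<close> and \<open>g\<close> are the two binomial densities.\<close>

lemma contaminations_coincide:
  assumes eps: "0 < \<epsilon>" "\<epsilon> \<le> 1" and pq: "p \<in> {0..1}" "q \<in> {0..1}"
    and tv: "binomial_tv m p q \<le> \<epsilon>"
  obtains Q Q' where "Q \<in> distributions" "Q' \<in> distributions"
    "contaminated m \<epsilon> p Q = contaminated m \<epsilon> q Q'"
proof -
  define f g where "f = binomial_weight m p" and "g = binomial_weight m q"
  have f: "f k \<ge> 0" for k using pq by (simp add: f_def binomial_weight_nonneg)
  have sf: "(\<Sum>k\<le>m. f k) = 1" by (simp add: f_def sum_binomial_weight)
  define T where "T = binomial_tv m p q"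
  define c where "c = (1 - \<epsilon>) / \<epsilon>"
  have c: "c \<ge> 0" "\<epsilon> * c = 1 - \<epsilon>" using eps by (auto simp: c_def)
  have T: "T \<ge> 0" "T \<le> \<epsilon>" using tv by (auto simp: T_def binomial_tv_nonneg)
  have "c * T \<le> c * \<epsilon>" using T c by (intro mult_left_mono)
  then have cT: "c * T \<le> 1" using c eps by (simp add: mult.commute)
  define h where "h = (\<lambda>k. c * max 0 (g k - f k) + (1 - c * T) * f k)"
  define h' where "h' = (\<lambda>k. c * max 0 (f k - g k) + (1 - c * T) * f k)"
  have hs: "h k \<ge> 0" "h' k \<ge> 0" for k using c cT f by (auto simp: h_def h'_def)
  have Te: "T = (\<Sum>k\<le>m. max 0 (g k - f k))" "binomial_tv m q p = (\<Sum>k\<le>m. max 0 (f k - g k))"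
    by (simp_all add: T_def binomial_tv_def f_def g_def)
  have "(\<Sum>k\<le>m. h k) = c * T + (1 - c * T) * 1"
    unfolding h_def sum.distrib sum_distrib_left[symmetric] sf Te[symmetric] ..
  then have s: "(\<Sum>k\<le>m. h k) = 1" by simp
  have "(\<Sum>k\<le>m. h' k) = c * binomial_tv m q p + (1 - c * T) * 1"
    unfolding h'_def sum.distrib sum_distrib_left[symmetric] sf Te[symmetric] ..
  then have s': "(\<Sum>k\<le>m. h' k) = 1" by (simp add: T_def binomial_tv_commute[of m q p])
  obtain Q where Q: "Q \<in> distributions"
    "\<And>A. A \<in> sets borel \<Longrightarrow> emeasure Q A = ennreal (\<Sum>k\<le>m. h k * indicator A (real k))"
    using finite_law_exists[of h m] hs s by blast
  obtain Q' where Q': "Q' \<in> distributions"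
    "\<And>A. A \<in> sets borel \<Longrightarrow> emeasure Q' A = ennreal (\<Sum>k\<le>m. h' k * indicator A (real k))"
    using finite_law_exists[of h' m] hs s' by blast
  have comb: "ennreal (1 - \<epsilon>) * ennreal (\<Sum>k\<le>m. u k * indicator A (real k))
      + ennreal \<epsilon> * ennreal (\<Sum>k\<le>m. v k * indicator A (real k))
     = ennreal (\<Sum>k\<le>m. ((1 - \<epsilon>) * u k + \<epsilon> * v k) * indicator A (real k))"
    if "\<And>k. u k \<ge> 0" "\<And>k. v k \<ge> 0" for u v :: "nat \<Rightarrow> real" and A
  proof -
    define U V where "U = (\<Sum>k\<le>m. u k * indicator A (real k))"
      and "V = (\<Sum>k\<le>m. v k * indicator A (real k))"
    have "U \<ge> 0" "V \<ge> 0"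
      using that by (auto simp: U_def V_def intro!: sum_nonneg)
    moreover have "(\<Sum>k\<le>m. ((1 - \<epsilon>) * u k + \<epsilon> * v k) * indicator A (real k)) = (1 - \<epsilon>) * U + \<epsilon> * V"
      by (simp only: U_def V_def sum_distrib_left sum.distrib distrib_right mult.assoc)
    ultimately show ?thesis using eps
      unfolding U_def[symmetric] V_def[symmetric] by (simp add: ennreal_mult'' ennreal_plus)
  qed
  have "contaminated m \<epsilon> p Q = contaminated m \<epsilon> q Q'"
  proof (rule measure_eqI)
    fix A assume "A \<in> sets (contaminated m \<epsilon> p Q)"
    then have A: "A \<in> sets borel" by simp
    have e: "(1 - \<epsilon>) * f k + \<epsilon> * h k = (1 - \<epsilon>) * g k + \<epsilon> * h' k" for k
    proof -
      have "\<epsilon> * h k = (1 - \<epsilon>) * max 0 (g k - f k) + \<epsilon> * ((1 - c * T) * f k)"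
        unfolding h_def c(2)[symmetric] by (simp add: algebra_simps)
      moreover have "\<epsilon> * h' k = (1 - \<epsilon>) * max 0 (f k - g k) + \<epsilon> * ((1 - c * T) * f k)"
        unfolding h'_def c(2)[symmetric] by (simp add: algebra_simps)
      moreover have "(1 - \<epsilon>) * f k + (1 - \<epsilon>) * max 0 (g k - f k) = (1 - \<epsilon>) * g k
          + (1 - \<epsilon>) * max 0 (f k - g k)"
        unfolding distrib_left[symmetric] by (simp add: max_def)
      ultimately show ?thesis by linarith
    qed
    have g: "g k \<ge> 0" for k using pq by (simp add: g_def binomial_weight_nonneg)
    show "emeasure (contaminated m \<epsilon> p Q) A = emeasure (contaminated m \<epsilon> q Q') A"
      unfolding emeasure_contaminated[OF Q(1) A] emeasure_contaminated[OF Q'(1) A]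
        emeasure_binomial_law[OF pq(1) A] emeasure_binomial_law[OF pq(2) A] Q(2)[OF A] Q'(2)[OF A]
        binomial_mean_def f_def[symmetric] g_def[symmetric]
      by (simp only: comb[OF f hs(1)] comb[OF g hs(2)] e)
  qed simp
  then show ?thesis using that Q Q' by blast
qed

lemma est_error_ge_by_contamination:
  assumes \<alpha>: "0 \<le> \<alpha>" "\<alpha> < 1 / 3" and eps: "0 < \<epsilon>" "\<epsilon> \<le> 1"
    and pq: "p \<in> {0..1}" "q \<in> {0..1}" and tv: "binomial_tv m p q \<le> \<epsilon>"
  shows "est_error n m \<alpha> \<epsilon> p \<ge> \<bar>p - q\<bar> / 2"
proof -
  obtain Q Q' where Q: "Q \<in> distributions" "Q' \<in> distributions"
    and eq: "contaminated m \<epsilon> p Q = contaminated m \<epsilon> q Q'"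
    using contaminations_coincide[OF eps pq tv] by blast
  show ?thesis
    by (rule est_error_ge_half_gap[OF \<alpha> _ pq Q]) (use eps in \<open>auto simp: sample_law_def eq\<close>)
qed

lemma PiM_density:
  fixes l :: "real \<Rightarrow> ennreal"
  assumes N: "prob_space N" and l: "l \<in> borel_measurable N" and D: "prob_space (density N l)" and I: "finite I"
  shows "PiM I (\<lambda>_. density N l) = density (PiM I (\<lambda>_. N)) (\<lambda>x. \<Prod>i\<in>I. l (x i))"
proof -
  interpret N: prob_space N by (rule N)
  interpret D: prob_space "density N l" by (rule D)
  interpret PN: product_sigma_finite "\<lambda>_. N" ..
  interpret PD: product_sigma_finite "\<lambda>_. density N l" ..
  note [measurable] = l
  show ?thesis
  proof (rule PD.PiM_eqI[OF I, symmetric])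
    show "sets (density (PiM I (\<lambda>_. N)) (\<lambda>x. \<Prod>i\<in>I. l (x i))) = sets (PiM I (\<lambda>_. density N l))"
      by (simp cong: sets_PiM_cong)
    fix A assume "\<And>i. i \<in> I \<Longrightarrow> A i \<in> sets (density N l)"
    then have A [measurable]: "\<And>i. i \<in> I \<Longrightarrow> A i \<in> sets N" by simp
    have [measurable]: "PiE I A \<in> sets (PiM I (\<lambda>_. N))"
      using A I by (intro sets_PiM_I_finite) auto
    have "emeasure (density (PiM I (\<lambda>_. N)) (\<lambda>x. \<Prod>i\<in>I. l (x i))) (PiE I A)
       = (\<integral>\<^sup>+x. (\<Prod>i\<in>I. l (x i)) * indicator (PiE I A) x \<partial>PiM I (\<lambda>_. N))"
      by (rule emeasure_density) measurable
    also have "\<dots> = (\<integral>\<^sup>+x. (\<Prod>i\<in>I. l (x i) * indicator (A i) (x i)) \<partial>PiM I (\<lambda>_. N))"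
    proof (rule nn_integral_cong)
      fix x assume "x \<in> space (PiM I (\<lambda>_. N))"
      then have "x \<in> PiE I A \<longleftrightarrow> (\<forall>i\<in>I. x i \<in> A i)" by (auto simp: space_PiM PiE_def Pi_def)
      then have "indicator (PiE I A) x = (\<Prod>i\<in>I. indicator (A i) (x i) :: ennreal)"
        using I by (auto simp: indicator_def prod_zero_iff)
      then show "(\<Prod>i\<in>I. l (x i)) * indicator (PiE I A) x = (\<Prod>i\<in>I. l (x i) * indicator (A i) (x i))"
        by (simp add: prod.distrib)
    qed
    also have "\<dots> = (\<Prod>i\<in>I. \<integral>\<^sup>+x. l x * indicator (A i) x \<partial>N)"
      by (rule PN.product_nn_integral_prod[OF I]) measurable
    also have "\<dots> = (\<Prod>i\<in>I. emeasure (density N l) (A i))"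
      by (intro prod.cong refl) (simp add: emeasure_density A)
    finally show "emeasure (density (PiM I (\<lambda>_. N)) (\<lambda>x. \<Prod>i\<in>I. l (x i))) (PiE I A)
        = (\<Prod>i\<in>I. emeasure (density N l) (A i))" .
  qed
qed

text \<open>A likelihood ratio with second moment at most \<open>10 / 9\<close> changes probabilities by at
  most \<open>1 / 3\<close>.\<close>

lemma second_moment_gap:
  assumes M: "prob_space M" and Z: "integrable M Z" "integrable M (\<lambda>x. (Z x)\<^sup>2)"
      "AE x in M. 0 \<le> Z x"
    and EZ: "(\<integral>x. Z x \<partial>M) = 1" and EZ2: "(\<integral>x. (Z x)\<^sup>2 \<partial>M) \<le> 10 / 9" and A: "A \<in> sets M"
  shows "measure M A \<le> measure (density M (\<lambda>x. ennreal (Z x))) A + 1 / 3"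
proof -
  interpret M: prob_space M by (rule M)
  have [measurable]: "Z \<in> borel_measurable M" using Z by simp
  note [measurable] = A
  have iA: "integrable M (\<lambda>x. Z x * indicator A x)" "integrable M (\<lambda>x. indicator A x :: real)"
    using Z A by (auto intro!: integrable_real_mult_indicator simp: less_top[symmetric])
  have "emeasure (density M (\<lambda>x. ennreal (Z x))) A = (\<integral>\<^sup>+x. ennreal (Z x) * indicator A x \<partial>M)"
    by (rule emeasure_density) measurable
  also have "\<dots> = (\<integral>\<^sup>+x. ennreal (Z x * indicator A x) \<partial>M)"
    by (intro nn_integral_cong) (auto simp: indicator_def)
  also have "\<dots> = ennreal (\<integral>x. Z x * indicator A x \<partial>M)"
    using Z(3) by (intro nn_integral_eq_integral iA) (auto elim!: eventually_mono)
  finally have "measure (density M (\<lambda>x. ennreal (Z x))) A = (\<integral>x. Z x * indicator A x \<partial>M)"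
    unfolding measure_def using Z(3)
    by (auto intro!: enn2real_ennreal integral_nonneg_AE elim!: eventually_mono)
  then have "measure M A - measure (density M (\<lambda>x. ennreal (Z x))) A =
      (\<integral>x. indicator A x - Z x * indicator A x \<partial>M)"
    using iA A by simp
  also have "\<dots> \<le> (\<integral>x. (3 / 2 * (Z x)\<^sup>2 - 3 * Z x) + 5 / 3 \<partial>M)"
  proof (rule integral_mono)
    fix x
    \<comment> \<open>The quadratic majorant touches \<open>1 - Z\<close> at \<open>1 - Z = 1 / 3\<close>, the optimal point for \<open>E (1 - Z)\<^sup>2 = 1 / 9\<close>.\<close>
    have *: "(3 / 2 * (Z x)\<^sup>2 - 3 * Z x) + 5 / 3 = 3 / 2 * (1 - Z x)\<^sup>2 + 1 / 6"
      by (simp add: power2_eq_square field_simps)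
    have "3 / 2 * (1 - Z x)\<^sup>2 + 1 / 6 - (1 - Z x) = 3 / 2 * (1 - Z x - 1 / 3)\<^sup>2"
      by (simp add: power2_eq_square field_simps)
    then have "1 - Z x \<le> 3 / 2 * (1 - Z x)\<^sup>2 + 1 / 6"
      using zero_le_power2[of "1 - Z x - 1 / 3"] by linarith
    then show "indicator A x - Z x * indicator A x \<le> (3 / 2 * (Z x)\<^sup>2 - 3 * Z x) + 5 / 3"
      unfolding * by (auto simp: indicator_def)
  qed (use iA Z in auto)
  also have "\<dots> = (3 / 2 * (\<integral>x. (Z x)\<^sup>2 \<partial>M) - 3 * (\<integral>x. Z x \<partial>M)) + 5 / 3"
    using Z by (simp add: M.prob_space)
  also have "\<dots> \<le> 1 / 3" using EZ EZ2 by simp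
  finally show ?thesis by simp
qed

text \<open>Here both hypotheses are contaminated by \<open>Binomial(m, q)\<close>, which makes the second
  mixture equal to \<open>Binomial(m, q)\<close> itself and the likelihood ratio of the first one, per observation, a
  convex combination of \<open>1\<close> and the ratio of the binomial laws; its second moment is at most
  \<open>(1 + (p - q)\<^sup>2 / (q (1 - q))) ^ m\<close>.\<close>

lemma est_error_ge_by_sampling:
  assumes \<alpha>: "0 \<le> \<alpha>" "\<alpha> < 1 / 3" and eps: "\<epsilon> \<in> {0..1}"
    and p: "p \<in> {0..1}" and q: "0 < q" "q < 1"
    and chi: "(1 + (p - q)\<^sup>2 / (q * (1 - q))) ^ (n * m) \<le> 10 / 9"
  shows "est_error n m \<alpha> \<epsilon> p \<ge> \<bar>p - q\<bar> / 2"
proof -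
  have q': "q \<in> {0..1}" using q by auto
  define N where "N = binomial_law m q"
  have ND: "N \<in> distributions" unfolding N_def by (rule binomial_law_distribution)
  interpret N: prob_space N using ND by (simp add: distributions_def)
  have sN [measurable_cong, simp]: "sets N = sets borel" by (simp add: N_def)
  define f g where "f = binomial_weight m p" and "g = binomial_weight m q"
  have f: "f k \<ge> 0" for k using p by (simp add: f_def binomial_weight_nonneg)
  have g: "g k > 0" if "k \<le> m" for k using binomial_weight_pos[OF q that] by (simp add: g_def)
  define l where "l = (\<lambda>x. \<epsilon> + (1 - \<epsilon>) * (f (to_count m x) / g (to_count m x)))"
  have [measurable]: "l \<in> borel_measurable borel" unfolding l_def by measurable
  have l0: "l x \<ge> 0" for x
    unfolding l_def using eps f g[OF to_count_le[of m x]] by (auto simp: order.strict_implies_order)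
  have l_nat: "g k * l (real k) = \<epsilon> * g k + (1 - \<epsilon>) * f k" if "k \<le> m" for k
    using g[OF that] that by (simp add: l_def field_simps)
  have int_N: "integrable N h" if "h \<in> borel_measurable borel" for h :: "real \<Rightarrow> real"
    unfolding N_def binomial_law_def by (subst integrable_distr_eq) (use that q' in auto)
  have qq: "contaminated m \<epsilon> q N = N"
  proof (rule measure_eqI)
    fix A assume "A \<in> sets (contaminated m \<epsilon> q N)"
    then have "emeasure (contaminated m \<epsilon> q N) A = (ennreal (1 - \<epsilon>) + ennreal \<epsilon>) * emeasure N A"
      using ND by (simp add: emeasure_contaminated N_def distrib_right)
    also have "ennreal (1 - \<epsilon>) + ennreal \<epsilon> = 1" using eps by (simp flip: ennreal_plus)
    finally show "emeasure (contaminated m \<epsilon> q N) A = emeasure N A" by simp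
  qed simp
  have pq: "contaminated m \<epsilon> p N = density N (\<lambda>x. ennreal (l x))"
  proof (rule measure_eqI)
    fix A assume "A \<in> sets (contaminated m \<epsilon> p N)"
    then have A [measurable]: "A \<in> sets borel" by simp
    have "emeasure (density N (\<lambda>x. ennreal (l x))) A = (\<integral>\<^sup>+x. ennreal (l x) * indicator A x \<partial>N)"
      by (rule emeasure_density) auto
    also have "\<dots> = (\<integral>\<^sup>+x. ennreal (l x * indicator A x) \<partial>N)"
      by (intro nn_integral_cong) (auto simp: indicator_def)
    also have "\<dots> = ennreal (binomial_mean m q (\<lambda>k. l (real k) * indicator A (real k)))"
      unfolding N_def by (rule nn_integral_binomial_law[OF q']) (use l0 in auto)
    also have "binomial_mean m q (\<lambda>k. l (real k) * indicator A (real k)) =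
        (\<Sum>k\<le>m. (\<epsilon> * g k + (1 - \<epsilon>) * f k) * indicator A (real k))"
      unfolding binomial_mean_def g_def[symmetric]
      by (intro sum.cong refl) (simp add: l_nat flip: mult.assoc)
    also have "\<dots> = (1 - \<epsilon>) * binomial_mean m p (\<lambda>k. indicator A (real k))
        + \<epsilon> * binomial_mean m q (\<lambda>k. indicator A (real k))"
      unfolding binomial_mean_def g_def[symmetric] f_def[symmetric]
      by (simp only: sum_distrib_left sum.distrib distrib_right mult.assoc add.commute)
    finally have "emeasure (density N (\<lambda>x. ennreal (l x))) A
        = ennreal ((1 - \<epsilon>) * binomial_mean m p (\<lambda>k. indicator A (real k))
            + \<epsilon> * binomial_mean m q (\<lambda>k. indicator A (real k)))" .
    moreover have "0 \<le> binomial_mean m t (\<lambda>k. indicator A (real k))" if "t \<in> {0..1}" for t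
      using binomial_mean_mono[OF that, of m "\<lambda>_. 0" "\<lambda>k. indicator A (real k)"] by simp
    ultimately show "emeasure (contaminated m \<epsilon> p N) A = emeasure (density N (\<lambda>x. ennreal (l x))) A"
      using eps p q' unfolding emeasure_contaminated[OF ND A]
      by (simp add: N_def emeasure_binomial_law A ennreal_mult'' ennreal_plus)
  qed simp
  define P where "P = PiM {..<n} (\<lambda>_. N)"
  interpret PN: product_sigma_finite "\<lambda>_::nat. N" ..
  interpret P: prob_space P unfolding P_def by (intro prob_space_PiM N.prob_space_axioms)
  define Z where "Z = (\<lambda>x. \<Prod>i<n. l (x i))"
  have El: "(\<integral>x. l x \<partial>N) = 1"
  proof -
    have "(\<integral>x. l x \<partial>N) = (\<Sum>k\<le>m. g k * l (real k))"
      unfolding N_def by (subst integral_binomial_law[OF q']) (auto simp: binomial_mean_def g_def)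
    also have "\<dots> = (\<Sum>k\<le>m. \<epsilon> * g k + (1 - \<epsilon>) * f k)" by (intro sum.cong refl l_nat) simp
    also have "\<dots> = 1"
        by (simp add: sum.distrib f_def g_def sum_binomial_weight flip: sum_distrib_left)
    finally show ?thesis .
  qed
  define c where "c = (1 + (p - q)\<^sup>2 / (q * (1 - q))) ^ m"
  have c1: "c \<ge> 1" unfolding c_def using q by (intro one_le_power) auto
  have El2: "(\<integral>x. (l x)\<^sup>2 \<partial>N) \<le> c"
  proof -
    have "(\<integral>x. (l x)\<^sup>2 \<partial>N) = (\<Sum>k\<le>m. g k * (l (real k))\<^sup>2)"
      unfolding N_def by (subst integral_binomial_law[OF q']) (auto simp: binomial_mean_def g_def)
    also have "\<dots> = (\<Sum>k\<le>m. \<epsilon>\<^sup>2 * g k + 2 * \<epsilon> * (1 - \<epsilon>) * f k + (1 - \<epsilon>)\<^sup>2 * ((f k)\<^sup>2 / g k))"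
    proof (intro sum.cong refl)
      fix k assume "k \<in> {..m}"
      then have k: "k \<le> m" by simp
      show "g k * (l (real k))\<^sup>2 = \<epsilon>\<^sup>2 * g k + 2 * \<epsilon> * (1 - \<epsilon>) * f k + (1 - \<epsilon>)\<^sup>2 * ((f k)\<^sup>2 / g k)"
        using g[OF k] k by (simp add: l_def power2_eq_square field_simps)
    qed
    also have "\<dots> = \<epsilon>\<^sup>2 * 1 + 2 * \<epsilon> * (1 - \<epsilon>) * 1 + (1 - \<epsilon>)\<^sup>2 * c"
      unfolding sum.distrib sum_distrib_left[symmetric] c_def chi_square_binomial[OF q, symmetric]
      by (simp add: f_def g_def sum_binomial_weight)
    also have "\<dots> \<le> \<epsilon>\<^sup>2 * c + 2 * \<epsilon> * (1 - \<epsilon>) * c + (1 - \<epsilon>)\<^sup>2 * c"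
      using c1 eps by (intro add_mono mult_left_mono) auto
    also have "\<dots> = c" by (simp add: power2_eq_square algebra_simps)
    finally show ?thesis .
  qed
  have Z2: "(Z x)\<^sup>2 = (\<Prod>i<n. (l (x i))\<^sup>2)" for x by (simp add: Z_def prod_power_distrib)
  have iZ: "integrable P Z"
    unfolding Z_def P_def by (intro PN.product_integrable_prod int_N) auto
  have iZ2: "integrable P (\<lambda>x. (Z x)\<^sup>2)"
    unfolding Z2 P_def by (intro PN.product_integrable_prod int_N) auto
  have EZ: "(\<integral>x. Z x \<partial>P) = 1"
    unfolding Z_def P_def by (subst PN.product_integral_prod) (auto intro: int_N simp: El)
  have "(\<integral>x. (Z x)\<^sup>2 \<partial>P) = (\<Prod>i<n. \<integral>x. (l x)\<^sup>2 \<partial>N)"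
    unfolding Z2 P_def by (intro PN.product_integral_prod int_N) auto
  also have "\<dots> \<le> (\<Prod>i<n. c)" using El2 by (intro prod_mono) auto
  also have "\<dots> = (1 + (p - q)\<^sup>2 / (q * (1 - q))) ^ (n * m)"
    by (simp add: c_def mult.commute flip: power_mult)
  finally have EZ2: "(\<integral>x. (Z x)\<^sup>2 \<partial>P) \<le> 10 / 9" using chi by simp
  have lawp: "sample_law n m \<epsilon> p N = density P (\<lambda>x. ennreal (Z x))"
  proof -
    have "prob_space (density N (\<lambda>x. ennreal (l x)))"
      using contaminated_distribution[OF ND eps, of m p] by (simp add: pq distributions_def)
    then have "sample_law n m \<epsilon> p N = density P (\<lambda>x. \<Prod>i<n. ennreal (l (x i)))"
      unfolding sample_law_def pq P_def
      by (intro PiM_density N.prob_space_axioms) auto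
    then show ?thesis using l0 by (simp add: Z_def prod_ennreal)
  qed
  have lawq: "sample_law n m \<epsilon> q N = P" by (simp add: sample_law_def qq P_def)
  show ?thesis
  proof (rule est_error_ge_half_gap[OF \<alpha> eps p q' ND ND])
    fix A assume A: "A \<in> sets (PiM {..<n} (\<lambda>_. borel :: real measure))"
    have "sets P = sets (PiM {..<n} (\<lambda>_. borel))" unfolding P_def by (intro sets_PiM_cong) auto
    with A show "measure (sample_law n m \<epsilon> q N) A \<le> measure (sample_law n m \<epsilon> p N) A + 1 / 3"
      unfolding lawp lawq using l0
      by (intro second_moment_gap P.prob_space_axioms iZ iZ2 EZ EZ2) (auto simp: Z_def prod_nonneg)
  qed
qed

text \<open>Moving from \<open>p\<close> towards \<open>1 / 2\<close> keeps \<open>q (1 - q)\<close> above a multiple of both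
  \<open>p (1 - p)\<close> and the distance moved, so that the end points need no separate treatment.\<close>

lemma neighbour_towards_half:
  fixes p d :: real
  assumes p: "p \<in> {0..1}" and d: "0 < d" "d \<le> 1 / 4"
  obtains q where "0 < q" "q < 1" "\<bar>p - q\<bar> = d"
    "p * (1 - p) \<le> 4 * (q * (1 - q))" "d \<le> 4 * (q * (1 - q))"
proof -
  have up: "t * (1 - t) \<le> 4 * ((t + d) * (1 - (t + d))) \<and> d \<le> 4 * ((t + d) * (1 - (t + d)))"
    if "0 \<le> t" "t \<le> 1 / 2" for t
  proof -
    define X where "X = (t + d) * (1 - (t + d))"
    have "(t + d) * (1 / 4) \<le> X"
      unfolding X_def using that d by (intro mult_left_mono) auto
    then have "t + d \<le> 4 * X" by simp
    moreover have "t * (1 - t) \<le> t" using that by (simp add: mult_left_le)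
    ultimately have "t * (1 - t) \<le> 4 * X \<and> d \<le> 4 * X"
      using that d by auto
    then show ?thesis unfolding X_def .
  qed
  show ?thesis
  proof (cases "p \<le> 1 / 2")
    case True
    then show ?thesis using up[of p] p d by (intro that[of "p + d"]) auto
  next
    case False
    then show ?thesis using up[of "1 - p"] p d
      by (intro that[of "p - d"]) (auto simp: algebra_simps)
  qed
qed

lemma one_plus_power_le_exp:
  fixes x :: real
  assumes "x \<ge> 0"
  shows "(1 + x) ^ k \<le> exp (real k * x)"
  using power_mono[OF exp_ge_add_one_self[of x], of k] assms
  by (simp add: exp_of_nat_mult)

text \<open>Each of the four summands of the rate is bounded on its own: those with \<open>n\<close> by the
  second moment of the likelihood ratio, those with \<open>\<epsilon>\<close> by matching contaminations.
  Each summand is at most \<open>80\<close> times the error.\<close>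

lemma estimation_lower_bound:
  assumes \<alpha>: "0 \<le> \<alpha>" "\<alpha> < 1 / 3" and n: "n \<ge> 1" and m: "m \<ge> 1"
    and eps: "\<epsilon> \<in> {0..1}" and p: "p \<in> {0..1}"
  shows "est_error n m \<alpha> \<epsilon> p \<ge> 1 / 320 * rate n m \<epsilon> p"
proof -
  define E where "E = est_error n m \<alpha> \<epsilon> p"
  have E0: "E \<ge> 0" unfolding E_def by (rule est_error_nonneg[OF \<alpha> eps p])
  define w where "w = p * (1 - p)"
  have w: "w \<ge> 0" using p by (simp add: w_def)
  have "w = 1 / 4 - (p - 1 / 2)\<^sup>2" by (simp add: w_def power2_eq_square algebra_simps)
  then have w4: "w \<le> 1 / 4" by simp
  define y where "y = sqrt (w / real m)"
  have y: "y \<ge> 0" "y\<^sup>2 = w / real m" using w by (auto simp: y_def)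
  have "w / real m \<le> (1 / 4) / 1" using w4 m w by (intro frac_le) auto
  then have "y \<le> sqrt (1 / 4)" unfolding y_def by (intro real_sqrt_le_mono) simp
  then have y1: "y \<le> 1 / 2" by (simp add: real_sqrt_divide)
  define R where "R = 1 / sqrt (real n)"
  have R: "R > 0" "R \<le> 1" "R\<^sup>2 = 1 / real n" using n by (auto simp: R_def power_divide)
  have sampling: "d / 2 \<le> E"
    if d: "0 < d" "d \<le> 1 / 4" and sm: "real (n * m) * d\<^sup>2 \<le> d / 40 \<or> real (n * m) * d\<^sup>2 \<le> w / 40"
        for d
  proof -
    obtain q where q: "0 < q" "q < 1" "\<bar>p - q\<bar> = d" "w \<le> 4 * (q * (1 - q))" "d \<le> 4 * (q * (1 - q))"
      unfolding w_def by (rule neighbour_towards_half[OF p d])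
    have pq: "(p - q)\<^sup>2 = d\<^sup>2" using q(3) by (metis power2_abs)
    have qq: "q * (1 - q) > 0" using q by simp
    have "real (n * m) * d\<^sup>2 \<le> (q * (1 - q)) / 10" using sm q by auto
    then have x: "real (n * m) * (d\<^sup>2 / (q * (1 - q))) \<le> 1 / 10"
      using qq by (simp add: field_simps)
    have "(1 + d\<^sup>2 / (q * (1 - q))) ^ (n * m) \<le> exp (real (n * m) * (d\<^sup>2 / (q * (1 - q))))"
      using qq by (intro one_plus_power_le_exp) auto
    also have "\<dots> \<le> exp (1 / 10)" using x by simp
    also have "\<dots> \<le> 1 + 1 / 10 + (1 / 10)\<^sup>2" by (rule exp_le_quadratic) simp
    also have "\<dots> \<le> 10 / 9" by (simp add: power2_eq_square)
    finally have "(1 + (p - q)\<^sup>2 / (q * (1 - q))) ^ (n * m) \<le> 10 / 9" by (simp add: pq)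
    from est_error_ge_by_sampling[OF \<alpha> eps p q(1,2) this] show ?thesis by (simp add: E_def q(3))
  qed
  have T1: "y * R \<le> 80 * E"
  proof (cases "y * R > 0")
    case True
    have "y * R \<le> 1 / 2 * 1" using y1 y R by (intro mult_mono) auto
    then have "y * R / 10 \<le> 1 / 4" by linarith
    moreover have "real (n * m) * (y * R / 10)\<^sup>2 \<le> w / 40"
      using n m w by (simp add: power_mult_distrib power_divide y R)
    ultimately have "y * R / 10 / 2 \<le> E" using True sampling[of "y * R / 10"] by simp
    then show ?thesis using E0 by simp
  qed (use E0 in linarith)
  have T3: "1 / real m * (1 / real n) \<le> 80 * E"
  proof -
    define d where "d = 1 / (40 * (real n * real m))"
    have nm: "1 \<le> real n * real m" using n m mult_mono[of 1 "real n" 1 "real m"] by simp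
    have "d > 0" using nm by (simp add: d_def)
    moreover have "d \<le> 1 / 4" using nm by (simp add: d_def field_simps)
    moreover have "real (n * m) * d\<^sup>2 \<le> d / 40"
      using nm by (simp add: d_def power2_eq_square field_simps)
    ultimately have "d / 2 \<le> E" by (intro sampling) auto
    then show ?thesis by (simp add: d_def field_simps)
  qed
  have T2: "y * \<epsilon> \<le> 80 * E"
  proof (cases "y * \<epsilon> > 0")
    case True
    then have e: "\<epsilon> > 0" "\<epsilon> \<le> 1" using eps y by (auto simp: zero_less_mult_iff)
    define d where "d = y * \<epsilon> / 10"
    have "y * \<epsilon> \<le> 1 / 2 * 1" using y1 y e by (intro mult_mono) auto
    then have "d \<le> 1 / 4" unfolding d_def by linarith
    then have d: "0 < d" "d \<le> 1 / 4" using True by (auto simp: d_def)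
    obtain q where q: "0 < q" "q < 1" "\<bar>p - q\<bar> = d" "w \<le> 4 * (q * (1 - q))" "d \<le> 4 * (q * (1 - q))"
      unfolding w_def by (rule neighbour_towards_half[OF p d])
    have pq: "(p - q)\<^sup>2 = d\<^sup>2" using q(3) by (metis power2_abs)
    have qq: "q * (1 - q) > 0" using q by simp
    have "real m * d\<^sup>2 = w * \<epsilon>\<^sup>2 / 100"
      using m by (simp add: d_def power_mult_distrib power_divide y)
    also have "\<dots> \<le> (4 * (q * (1 - q))) * \<epsilon>\<^sup>2 / 100"
      using q by (intro divide_right_mono mult_right_mono) auto
    finally have x: "real m * (d\<^sup>2 / (q * (1 - q))) \<le> \<epsilon>\<^sup>2 / 25"
      using qq by (simp add: field_simps)
    have e2: "\<epsilon>\<^sup>2 \<le> 1" using e by (simp add: power_le_one)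
    have "(binomial_tv m p q)\<^sup>2 \<le> (1 + d\<^sup>2 / (q * (1 - q))) ^ m - 1"
      using binomial_tv_le_chi_square[OF p q(1,2), of m] by (simp add: pq)
    also have "(1 + d\<^sup>2 / (q * (1 - q))) ^ m \<le> exp (real m * (d\<^sup>2 / (q * (1 - q))))"
      using qq by (intro one_plus_power_le_exp) auto
    also have "\<dots> \<le> exp (\<epsilon>\<^sup>2 / 25)" using x by simp
    also have "\<dots> \<le> 1 + \<epsilon>\<^sup>2 / 25 + (\<epsilon>\<^sup>2 / 25)\<^sup>2" using e2 by (intro exp_le_quadratic) simp
    also have "(\<epsilon>\<^sup>2 / 25)\<^sup>2 \<le> \<epsilon>\<^sup>2 / 25"
      using e2 mult_left_mono[of "\<epsilon>\<^sup>2 / 25" 1 "\<epsilon>\<^sup>2 / 25"] by (simp add: power2_eq_square)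
    finally have "(binomial_tv m p q)\<^sup>2 \<le> \<epsilon>\<^sup>2"
      using zero_le_power2[of \<epsilon>] by linarith
    then have "binomial_tv m p q \<le> \<epsilon>" by (rule power2_le_imp_le) (use e in simp)
    then have "\<bar>p - q\<bar> / 2 \<le> E"
      unfolding E_def using q by (intro est_error_ge_by_contamination[OF \<alpha> e p]) auto
    then show ?thesis using E0 by (simp add: q(3) d_def)
  qed (use E0 in linarith)
  have T4: "1 / real m * \<epsilon> \<le> 80 * E"
  proof (cases "\<epsilon> > 0")
    case True
    then have e: "\<epsilon> > 0" "\<epsilon> \<le> 1" using eps by auto
    define d where "d = \<epsilon> / (4 * real m)"
    have d: "0 < d" "d \<le> 1 / 4" using e m by (auto simp: d_def field_simps)
    obtain q where q: "0 < q" "q < 1" "\<bar>p - q\<bar> = d"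
      by (rule neighbour_towards_half[OF p d])
    have "binomial_tv m p q \<le> real m * d"
      using binomial_tv_le_lipschitz[of p q m] p q by simp
    also have "\<dots> \<le> \<epsilon>" using m e by (simp add: d_def)
    finally have "\<bar>p - q\<bar> / 2 \<le> E"
      unfolding E_def using q by (intro est_error_ge_by_contamination[OF \<alpha> e p]) auto
    then have "d \<le> 2 * E" by (simp add: q(3))
    then show ?thesis using E0 by (simp add: d_def)
  next
    case False
    then show ?thesis using E0 eps by simp
  qed
  have "rate n m \<epsilon> p = y * R + y * \<epsilon> + 1 / real m * (1 / real n) + 1 / real m * \<epsilon>"
    by (simp add: rate_def y_def w_def R_def algebra_simps)
  then show ?thesis using T1 T2 T3 T4 unfolding E_def[symmetric] by linarith
qed

section \<open>The minimax rate\<close>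

theorem theorem3:
  shows "(\<forall>\<alpha>::real. 0 < \<alpha> \<and> \<alpha> < 1/3 \<longrightarrow>
      (\<exists>c::real. c > 0 \<and>
        (\<forall>n m :: nat. n \<ge> 1 \<longrightarrow> m \<ge> 1 \<longrightarrow>
          (\<forall>\<epsilon>\<in>{0..1}. \<forall>p\<in>{0..1}. est_error n m \<alpha> \<epsilon> p \<ge> c * rate n m \<epsilon> p))))
   \<and> (\<exists>c0::real. c0 > 0 \<and>
      (\<forall>\<alpha>::real. 0 < \<alpha> \<and> \<alpha> < 1 \<longrightarrow>
        (\<exists>C::real. C > 0 \<and>
          (\<forall>n m :: nat. n \<ge> 1 \<longrightarrow> m \<ge> 1 \<longrightarrow>
            (\<exists>phat\<in>estimators n.
              \<forall>\<epsilon>\<in>{0..1}. ln (2 / \<alpha>) / real n + \<epsilon> \<le> c0 \<longrightarrow>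
                (INF (p, Q) \<in> {0..1} \<times> distributions.
                   \<P>(x in sample_law n m \<epsilon> p Q. \<bar>phat x - p\<bar> \<le> C * rate n m \<epsilon> p))
                \<ge> 1 - \<alpha>)))))"
proof (intro conjI)
  show "\<forall>\<alpha>::real. 0 < \<alpha> \<and> \<alpha> < 1/3 \<longrightarrow>
      (\<exists>c::real. c > 0 \<and>
        (\<forall>n m :: nat. n \<ge> 1 \<longrightarrow> m \<ge> 1 \<longrightarrow>
          (\<forall>\<epsilon>\<in>{0..1}. \<forall>p\<in>{0..1}. est_error n m \<alpha> \<epsilon> p \<ge> c * rate n m \<epsilon> p)))"
    by (intro allI impI exI[of _ "1 / 320"] conjI ballI estimation_lower_bound) auto
  show "\<exists>c0::real. c0 > 0 \<and>
      (\<forall>\<alpha>::real. 0 < \<alpha> \<and> \<alpha> < 1 \<longrightarrow>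
        (\<exists>C::real. C > 0 \<and>
          (\<forall>n m :: nat. n \<ge> 1 \<longrightarrow> m \<ge> 1 \<longrightarrow>
            (\<exists>phat\<in>estimators n.
              \<forall>\<epsilon>\<in>{0..1}. ln (2 / \<alpha>) / real n + \<epsilon> \<le> c0 \<longrightarrow>
                (INF (p, Q) \<in> {0..1} \<times> distributions.
                   \<P>(x in sample_law n m \<epsilon> p Q. \<bar>phat x - p\<bar> \<le> C * rate n m \<epsilon> p))
                \<ge> 1 - \<alpha>))))"
  proof (rule exI[of _ "1 / 4000000"], intro conjI allI impI)
    fix \<alpha> :: real assume \<alpha>: "0 < \<alpha> \<and> \<alpha> < 1"
    define C where "C = 504 * (1 + sqrt (ln (2 / \<alpha>)) + ln (2 / \<alpha>))"
    have "ln (2 / \<alpha>) > 0" using \<alpha> by simp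
    then have "C > 0" unfolding C_def by (intro mult_pos_pos add_pos_pos) auto
    moreover have "\<exists>phat\<in>estimators n.
        \<forall>\<epsilon>\<in>{0..1}. ln (2 / \<alpha>) / real n + \<epsilon> \<le> 1 / 4000000 \<longrightarrow>
          (INF (p, Q) \<in> {0..1} \<times> distributions.
             \<P>(x in sample_law n m \<epsilon> p Q. \<bar>phat x - p\<bar> \<le> C * rate n m \<epsilon> p)) \<ge> 1 - \<alpha>"
      if "n \<ge> 1" "m \<ge> 1" for n m
      unfolding C_def using \<alpha> that
      by (intro bexI[OF _ sign_estimator_measurable[of n m]] ballI impI estimation_upper_bound) simp_all
    ultimately show "\<exists>C::real. C > 0 \<and>
        (\<forall>n m :: nat. n \<ge> 1 \<longrightarrow> m \<ge> 1 \<longrightarrow>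
          (\<exists>phat\<in>estimators n.
            \<forall>\<epsilon>\<in>{0..1}. ln (2 / \<alpha>) / real n + \<epsilon> \<le> 1 / 4000000 \<longrightarrow>
              (INF (p, Q) \<in> {0..1} \<times> distributions.
                 \<P>(x in sample_law n m \<epsilon> p Q. \<bar>phat x - p\<bar> \<le> C * rate n m \<epsilon> p)) \<ge> 1 - \<alpha>))"
      by blast
  qed simp
qed

end
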